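(* Let $d_{w,1}$ be a Lorentz sequence space (with $p=1$) and let $T\in L(d_{w,1})$. Then $T$ is weakly compact if and only if $T$ is strictly singular.
   Context: Let $w=(w_n)$ be a real sequence with $w_1=1$, $w_n\downarrow 0$ and $\sum_n w_n=\infty$. The Lorentz sequence space $d_{w,1}$ is the Banach space of all $x=(x_n)\in c_0$ with $\|x\|=\sum_{n}w_n x^*_n<\infty$, where $(x^*_n)$ is the non-increasing rearrangement of $(|x_n|)$. An operator is strictly singular if its restriction to no infinite-dimensional closed subspace is an isomorphism; it is weakly compact if it maps the unit ball to a relatively weakly compact set. *)

theory Defs
  imports "HOL-Analysis.Analysis"
begin

text \<open>Sequences are functions nat => real, indexed from 0 (so w 0 plays the role of w_1).\<close>

definition lorentz_weight :: "(nat \<Rightarrow> real) \<Rightarrow> bool" where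
  "lorentz_weight w \<longleftrightarrow> w 0 = 1 \<and> decseq w \<and> w \<longlonglongrightarrow> 0 \<and> \<not> summable w"

text \<open>Non-increasing rearrangement of (|x_n|), 0-indexed:
  x*_n = inf { s >= 0 : #{k. |x_k| > s} <= n }.\<close>
definition rearr :: "(nat \<Rightarrow> real) \<Rightarrow> nat \<Rightarrow> real" where
  "rearr x n = Inf {s. 0 \<le> s \<and> finite {k. s < \<bar>x k\<bar>} \<and> card {k. s < \<bar>x k\<bar>} \<le> n}"

definition lorentz_norm :: "(nat \<Rightarrow> real) \<Rightarrow> (nat \<Rightarrow> real) \<Rightarrow> real" where
  "lorentz_norm w x = (\<Sum>n. w n * rearr x n)"

definition lorentz_space :: "(nat \<Rightarrow> real) \<Rightarrow> (nat \<Rightarrow> real) set" where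
  "lorentz_space w = {x. x \<longlonglongrightarrow> 0 \<and> summable (\<lambda>n. w n * rearr x n)}"

definition bounded_op :: "(nat \<Rightarrow> real) \<Rightarrow> ((nat \<Rightarrow> real) \<Rightarrow> (nat \<Rightarrow> real)) \<Rightarrow> bool" where
  "bounded_op w T \<longleftrightarrow>
     (\<forall>x\<in>lorentz_space w. T x \<in> lorentz_space w) \<and>
     (\<forall>x\<in>lorentz_space w. \<forall>y\<in>lorentz_space w. \<forall>a b::real.
         T (\<lambda>k. a * x k + b * y k) = (\<lambda>k. a * T x k + b * T y k)) \<and>
     (\<exists>C. \<forall>x\<in>lorentz_space w. lorentz_norm w (T x) \<le> C * lorentz_norm w x)"

definition lorentz_dual :: "(nat \<Rightarrow> real) \<Rightarrow> ((nat \<Rightarrow> real) \<Rightarrow> real) set" where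
  "lorentz_dual w = {f.
     (\<forall>x\<in>lorentz_space w. \<forall>y\<in>lorentz_space w. \<forall>a b::real.
         f (\<lambda>k. a * x k + b * y k) = a * f x + b * f y) \<and>
     (\<exists>C. \<forall>x\<in>lorentz_space w. \<bar>f x\<bar> \<le> C * lorentz_norm w x)}"

definition weak_top :: "(nat \<Rightarrow> real) \<Rightarrow> (nat \<Rightarrow> real) topology" where
  "weak_top w = topology_generated_by
     {{x \<in> lorentz_space w. f x \<in> U} | f U. f \<in> lorentz_dual w \<and> open U}"

definition unit_ball :: "(nat \<Rightarrow> real) \<Rightarrow> (nat \<Rightarrow> real) set" where
  "unit_ball w = {x \<in> lorentz_space w. lorentz_norm w x \<le> 1}"

definition weakly_compact_op :: "(nat \<Rightarrow> real) \<Rightarrow> ((nat \<Rightarrow> real) \<Rightarrow> (nat \<Rightarrow> real)) \<Rightarrow> bool" where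
  "weakly_compact_op w T \<longleftrightarrow>
     compactin (weak_top w) (weak_top w closure_of (T ` unit_ball w))"

definition closed_subspace :: "(nat \<Rightarrow> real) \<Rightarrow> (nat \<Rightarrow> real) set \<Rightarrow> bool" where
  "closed_subspace w M \<longleftrightarrow>
     M \<subseteq> lorentz_space w \<and> (\<lambda>k. 0) \<in> M \<and>
     (\<forall>x\<in>M. \<forall>y\<in>M. \<forall>a b::real. (\<lambda>k. a * x k + b * y k) \<in> M) \<and>
     (\<forall>x\<in>lorentz_space w. \<forall>s::nat \<Rightarrow> nat \<Rightarrow> real.
         (\<forall>m. s m \<in> M) \<and> (\<lambda>m. lorentz_norm w (\<lambda>k. s m k - x k)) \<longlonglongrightarrow> 0 \<longrightarrow> x \<in> M)"

definition infinite_dim :: "(nat \<Rightarrow> real) set \<Rightarrow> bool" where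
  "infinite_dim M \<longleftrightarrow>
     (\<forall>n. \<exists>v::nat \<Rightarrow> nat \<Rightarrow> real. (\<forall>i<n. v i \<in> M) \<and>
        (\<forall>c::nat \<Rightarrow> real. (\<forall>k. (\<Sum>i<n. c i * v i k) = 0) \<longrightarrow> (\<forall>i<n. c i = 0)))"

text \<open>T is strictly singular: its restriction to no infinite-dimensional closed subspace is an
  isomorphism (onto its image); for bounded T this means bounded below on that subspace.\<close>
definition strictly_singular :: "(nat \<Rightarrow> real) \<Rightarrow> ((nat \<Rightarrow> real) \<Rightarrow> (nat \<Rightarrow> real)) \<Rightarrow> bool" where
  "strictly_singular w T \<longleftrightarrow>
     \<not> (\<exists>M. closed_subspace w M \<and> infinite_dim M \<and>
           (\<exists>c>0. \<forall>x\<in>M. c * lorentz_norm w x \<le> lorentz_norm w (T x)))"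

end

theory Submission
  imports Defs
begin

text \<open>By the Hardy-Littlewood inequality the Lorentz norm of x is the supremum of the sums of
  $w_{\pi(i)} |x_i|$ over finite sets of indices i and injections $\pi$; in this form the triangle
  inequality, the lattice and Fatou properties and the decay of tails are immediate.

  If for every functional f the values of f on the blocks of T x with indices in [m, q) tend to 0 as m
  grows, uniformly on the unit ball, then on the coordinatewise closure of the image of the ball the
  weak and the coordinatewise topology agree, and T is weakly compact. Otherwise a gliding hump
  applied to differences of a coordinatewise convergent subsequence yields bounded $x_j$ such that
  the $T x_j$ are close to disjoint blocks on which f stays large. The norm is a lattice norm, so
  signs do not matter and these blocks span a copy of $\ell_1$, whence T is an isomorphism on the
  closed span of the $x_j$.

  Conversely, if T is bounded below on an infinite-dimensional subspace, then the image of its unit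
  sphere contains vectors far out and with arbitrarily small supremum norm. A flat vector keeps
  almost all of its norm when the weights are shifted, so a single functional, with the weights
  assigned to consecutive vectors without overlap, is bounded away from 0 on a sequence of such
  images that tends to 0 coordinatewise. Such a sequence has no weak cluster point.\<close>

section \<open>Decreasing weights and the non-increasing rearrangement\<close>

lemma sum_le_sum_lessThan_card:
  fixes w :: "nat \<Rightarrow> real"
  assumes "decseq w" "finite A"
  shows "sum w A \<le> sum w {..<card A}"
  using assms(2)
proof (induction A rule: finite_linorder_max_induct)
  case empty
  then show ?case by simp
next
  case (insert b A)
  have "card A \<le> card {..<b}"
    by (rule card_mono) (use insert in auto)
  then have "w b \<le> w (card A)"
    using assms(1) by (simp add: decseq_def)
  moreover have "b \<notin> A" using insert by auto
  ultimately show ?case using insert by simp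
qed

text \<open>Abel summation by induction: passing from \<open>a N\<close> to the smaller
  \<open>a (Suc N)\<close> can only lower the left side, because the partial sums of
  \<open>d\<close> are nonnegative.\<close>

lemma sum_mult_decseq_ge:
  fixes a d :: "nat \<Rightarrow> real"
  assumes "decseq a" "\<And>m. 0 \<le> sum d {..<m}"
  shows "a N * sum d {..<N} \<le> (\<Sum>n<N. d n * a n)"
proof (induction N)
  case 0
  then show ?case by simp
next
  case (Suc N)
  have "a (Suc N) * sum d {..<Suc N} \<le> a N * sum d {..<Suc N}"
    by (rule mult_right_mono[OF _ assms(2)]) (use assms(1) in \<open>simp add: decseq_Suc_iff\<close>)
  also have "\<dots> = a N * sum d {..<N} + d N * a N"
    by (simp add: algebra_simps)
  also have "\<dots> \<le> (\<Sum>n<Suc N. d n * a n)" using Suc by simp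
  finally show ?case .
qed

text \<open>Each stage takes an index of largest modulus among those left. The range may miss
  indices: if a null sequence has infinitely many nonzero entries, its zeros are never
  chosen.\<close>

definition greedy :: "(nat \<Rightarrow> real) \<Rightarrow> (nat \<Rightarrow> nat) \<Rightarrow> bool" where
  "greedy x g \<longleftrightarrow> inj g \<and> (\<forall>n k. k \<notin> g ` {..<n} \<longrightarrow> \<bar>x k\<bar> \<le> \<bar>x (g n)\<bar>)"

lemma greedyD:
  assumes "greedy x g"
  shows "inj g" "k \<notin> g ` {..<n} \<Longrightarrow> \<bar>x k\<bar> \<le> \<bar>x (g n)\<bar>"
  using assms unfolding greedy_def by blast+

text \<open>Only finitely many entries of a null sequence reach a given positive level, so outside a
  finite set the largest modulus is attained; if only zeros remain there, any new index
  serves.\<close>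

lemma ex_greedy_enumeration:
  fixes x :: "nat \<Rightarrow> real"
  assumes "x \<longlonglongrightarrow> 0"
  obtains g :: "nat \<Rightarrow> nat" where "greedy x g"
proof -
  have fin: "finite {j. e \<le> \<bar>x j\<bar>}" if "e > 0" for e
  proof -
    have "\<forall>\<^sub>F n in sequentially. \<bar>x n\<bar> < e"
      using assms that by (simp add: tendsto_iff)
    then obtain m where m: "\<And>n. m \<le> n \<Longrightarrow> \<bar>x n\<bar> < e"
      by (auto simp: eventually_sequentially)
    have "{j. e \<le> \<bar>x j\<bar>} \<subseteq> {..<m}"
    proof
      fix j assume "j \<in> {j. e \<le> \<bar>x j\<bar>}"
      then show "j \<in> {..<m}" using m[of j] by (cases "m \<le> j") auto
    qed
    then show ?thesis by (rule finite_subset) simp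
  qed
  have sel: "\<exists>r. r \<notin> A \<and> (\<forall>k. k \<notin> A \<longrightarrow> \<bar>x k\<bar> \<le> \<bar>x r\<bar>)" if A: "finite A" for A
  proof (cases "\<exists>j. j \<notin> A \<and> x j \<noteq> 0")
    case True
    then obtain j where j: "j \<notin> A" "x j \<noteq> 0" by blast
    let ?S = "{i. \<bar>x j\<bar> \<le> \<bar>x i\<bar>} - A"
    have S: "finite ?S" "?S \<noteq> {}" using fin[of "\<bar>x j\<bar>"] j by auto
    have "Max ((\<lambda>i. \<bar>x i\<bar>) ` ?S) \<in> (\<lambda>i. \<bar>x i\<bar>) ` ?S"
      using S by (intro Max_in) auto
    then obtain r where r: "r \<in> ?S" "Max ((\<lambda>i. \<bar>x i\<bar>) ` ?S) = \<bar>x r\<bar>" by auto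
    have "\<bar>x k\<bar> \<le> \<bar>x r\<bar>" if "k \<notin> A" for k
    proof (cases "k \<in> ?S")
      case True
      then have "\<bar>x k\<bar> \<le> Max ((\<lambda>i. \<bar>x i\<bar>) ` ?S)" using S(1) by (intro Max_ge) auto
      then show ?thesis using r by simp
    next
      case False
      then show ?thesis using that r by auto
    qed
    then show ?thesis using r by auto
  next
    case False
    obtain r where "r \<notin> A" using ex_new_if_finite[OF infinite_UNIV_nat A] by blast
    then show ?thesis using False by (intro exI[of _ r]) auto
  qed
  \<comment> \<open>Each choice depends on the whole set of earlier ones, so the choices are made
    along the well-order of the naturals.\<close>
  have "\<exists>g::nat \<Rightarrow> nat. \<forall>n. g n \<notin> g ` {..<n} \<and> (\<forall>k. k \<notin> g ` {..<n} \<longrightarrow> \<bar>x k\<bar> \<le> \<bar>x (g n)\<bar>)"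
  proof (rule dependent_wellorder_choice[where P = "\<lambda>g n r. r \<notin> g ` {..<n} \<and>
      (\<forall>k. k \<notin> g ` {..<n} \<longrightarrow> \<bar>x k\<bar> \<le> \<bar>x r\<bar>)"])
    fix r :: nat and f g :: "nat \<Rightarrow> nat" and n :: nat
    assume "\<And>y. y < n \<Longrightarrow> f y = g y"
    then have "f ` {..<n} = g ` {..<n}" by (intro image_cong) auto
    then show "(r \<notin> f ` {..<n} \<and> (\<forall>k. k \<notin> f ` {..<n} \<longrightarrow> \<bar>x k\<bar> \<le> \<bar>x r\<bar>)) =
        (r \<notin> g ` {..<n} \<and> (\<forall>k. k \<notin> g ` {..<n} \<longrightarrow> \<bar>x k\<bar> \<le> \<bar>x r\<bar>))" by simp
  next
    fix n and f :: "nat \<Rightarrow> nat"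
    show "\<exists>r. r \<notin> f ` {..<n} \<and> (\<forall>k. k \<notin> f ` {..<n} \<longrightarrow> \<bar>x k\<bar> \<le> \<bar>x r\<bar>)"
      by (rule sel) simp
  qed
  then obtain g :: "nat \<Rightarrow> nat" where g: "\<And>n. g n \<notin> g ` {..<n}"
    "\<And>n k. k \<notin> g ` {..<n} \<Longrightarrow> \<bar>x k\<bar> \<le> \<bar>x (g n)\<bar>" by blast
  have "inj g"
  proof (rule linorder_injI)
    fix p q :: nat assume "p < q"
    then have "g p \<in> g ` {..<q}" by blast
    then show "g p \<noteq> g q" using g(1)[of q] by auto
  qed
  then have "greedy x g" using g(2) by (simp add: greedy_def)
  then show ?thesis by (rule that)
qed

lemma decseq_greedy:
  fixes x :: "nat \<Rightarrow> real"
  assumes "greedy x g"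
  shows "decseq (\<lambda>n. \<bar>x (g n)\<bar>)"
  unfolding decseq_Suc_iff
  by (intro allI greedyD(2)[OF assms]) (auto simp: inj_image_mem_iff[OF greedyD(1)[OF assms]])

text \<open>The infimum is a minimum: entries of larger modulus sit among the first n chosen
  indices, while any smaller level is exceeded at all of the first n + 1.\<close>

lemma rearr_greedy:
  assumes greedy: "greedy x g"
  shows "rearr x n = \<bar>x (g n)\<bar>"
  unfolding rearr_def
proof (rule cInf_eq_minimum)
  note g = greedyD[OF greedy]
  have sub: "{k. \<bar>x (g n)\<bar> < \<bar>x k\<bar>} \<subseteq> g ` {..<n}"
  proof (intro subsetI, rule ccontr)
    fix k assume "k \<in> {k. \<bar>x (g n)\<bar> < \<bar>x k\<bar>}" "k \<notin> g ` {..<n}"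
    then show False using g(2)[of k n] by simp
  qed
  have "card {k. \<bar>x (g n)\<bar> < \<bar>x k\<bar>} \<le> card (g ` {..<n})"
    by (rule card_mono[OF _ sub]) simp
  also have "\<dots> = n" using g(1) by (simp add: card_image inj_on_subset)
  finally show "\<bar>x (g n)\<bar> \<in> {s. 0 \<le> s \<and> finite {k. s < \<bar>x k\<bar>} \<and> card {k. s < \<bar>x k\<bar>} \<le> n}"
    using finite_subset[OF sub] by simp
next
  note g = greedyD[OF greedy]
  fix s assume s: "s \<in> {s. 0 \<le> s \<and> finite {k. s < \<bar>x k\<bar>} \<and> card {k. s < \<bar>x k\<bar>} \<le> n}"
  show "\<bar>x (g n)\<bar> \<le> s"
  proof (rule ccontr)
    assume "\<not> \<bar>x (g n)\<bar> \<le> s"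
    then have "s < \<bar>x (g i)\<bar>" if "i \<le> n" for i
      using decseqD[OF decseq_greedy[OF greedy] that] by linarith
    then have "g ` {..n} \<subseteq> {k. s < \<bar>x k\<bar>}" by auto
    then have "card (g ` {..n}) \<le> card {k. s < \<bar>x k\<bar>}"
      using s by (intro card_mono) auto
    then show False using s g(1) by (simp add: card_image inj_on_subset)
  qed
qed

lemma strict_mono_interval_unique:
  fixes P :: "nat \<Rightarrow> nat"
  assumes P: "strict_mono P" and i: "i \<in> {P j..<P (Suc j)}" "i \<in> {P k..<P (Suc k)}"
  shows "j = k"
proof (rule ccontr)
  assume "j \<noteq> k"
  then have "Suc j \<le> k \<or> Suc k \<le> j" by linarith
  then have "P (Suc j) \<le> P k \<or> P (Suc k) \<le> P j"
    using strict_mono_leD[OF P] by blast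
  then show False using i by auto
qed

text \<open>Gaussian elimination: a trivial equation is dropped, any other is solved for one
  unknown, so equations run out before unknowns do.\<close>

lemma homogeneous_system_nontrivial:
  fixes A :: "'i \<Rightarrow> 'k \<Rightarrow> real"
  assumes "finite K" "finite I" "card K < card I"
  shows "\<exists>c. (\<exists>i\<in>I. c i \<noteq> 0) \<and> (\<forall>k\<in>K. (\<Sum>i\<in>I. c i * A i k) = 0)"
  using assms
proof (induction K arbitrary: I A rule: finite_induct)
  case empty
  then show ?case by (intro exI[of _ "\<lambda>_. 1"]) (auto simp: card_gt_0_iff)
next
  case (insert k K)
  show ?case
  proof (cases "\<forall>i\<in>I. A i k = 0")
    case True
    then show ?thesis using insert.IH[of I A] insert by auto
  next
    case False
    then obtain p where p: "p \<in> I" "A p k \<noteq> 0" by blast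
    let ?I = "I - {p}"
    \<comment> \<open>The coefficients that remain once equation \<open>k\<close> has been solved
      for the unknown \<open>p\<close>.\<close>
    let ?B = "\<lambda>i l. A i l - A i k / A p k * A p l"
    have "finite ?I" "card K < card ?I" using insert p by simp_all
    from insert.IH[OF this, of ?B]
    obtain c where c: "\<exists>i\<in>?I. c i \<noteq> 0" "\<And>l. l \<in> K \<Longrightarrow> (\<Sum>i\<in>?I. c i * ?B i l) = 0"
      by blast
    define d where "d i = (if i = p then - (\<Sum>i\<in>?I. c i * (A i k / A p k)) else c i)" for i
    have eq: "(\<Sum>i\<in>I. d i * A i l) = (\<Sum>i\<in>?I. c i * ?B i l)" for l
    proof -
      have "(\<Sum>i\<in>I. d i * A i l) = d p * A p l + (\<Sum>i\<in>?I. d i * A i l)"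
        using insert.prems p by (intro sum.remove) auto
      also have "(\<Sum>i\<in>?I. d i * A i l) = (\<Sum>i\<in>?I. c i * A i l)"
        by (rule sum.cong) (auto simp: d_def)
      also have "d p * A p l = - (\<Sum>i\<in>?I. c i * (A i k / A p k * A p l))"
        by (simp add: d_def sum_distrib_right mult.assoc)
      also have "- (\<Sum>i\<in>?I. c i * (A i k / A p k * A p l)) + (\<Sum>i\<in>?I. c i * A i l)
          = (\<Sum>i\<in>?I. c i * ?B i l)"
        by (simp only: right_diff_distrib sum_subtractf)
      finally show ?thesis .
    qed
    have "(\<Sum>i\<in>I. d i * A i k) = 0" unfolding eq using p(2) by simp
    moreover have "\<exists>i\<in>I. d i \<noteq> 0" using c(1) by (auto simp: d_def)
    ultimately show ?thesis using eq c(2) by (intro exI[of _ d]) auto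
  qed
qed

section \<open>The Lorentz norm as a supremum over injections\<close>

text \<open>The supremum form of the norm being at most \<open>B\<close>, with no prior membership
  in the space. Each condition involves finitely many moduli, so it behaves well under linear
  combinations, domination and coordinatewise limits.\<close>

definition rearr_bound :: "(nat \<Rightarrow> real) \<Rightarrow> (nat \<Rightarrow> real) \<Rightarrow> real \<Rightarrow> bool" where
  "rearr_bound w x B \<longleftrightarrow>
     (\<forall>F \<pi>. finite F \<longrightarrow> inj_on \<pi> F \<longrightarrow> (\<Sum>i\<in>F. w (\<pi> i) * \<bar>x i\<bar>) \<le> B)"

lemma rearr_boundD:
  "rearr_bound w x B \<Longrightarrow> finite F \<Longrightarrow> inj_on \<pi> F \<Longrightarrow> (\<Sum>i\<in>F. w (\<pi> i) * \<bar>x i\<bar>) \<le> B"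
  unfolding rearr_bound_def by blast

definition proj :: "nat set \<Rightarrow> (nat \<Rightarrow> real) \<Rightarrow> nat \<Rightarrow> real" where
  "proj A x = (\<lambda>i. if i \<in> A then x i else 0)"

locale lorentz =
  fixes w :: "nat \<Rightarrow> real"
  assumes weight: "lorentz_weight w"
begin

abbreviation "X \<equiv> lorentz_space w"
abbreviation "N \<equiv> lorentz_norm w"

lemma w0: "w 0 = 1" and w_dec: "decseq w" and w_lim: "w \<longlonglongrightarrow> 0" and w_nonsum: "\<not> summable w"
  using weight by (auto simp: lorentz_weight_def)

lemma w_nonneg: "0 \<le> w i"
  using decseq_ge[OF w_dec w_lim] .

lemma w_le1: "w i \<le> 1"
  using w_dec w0 unfolding decseq_def by (metis le0)

lemma W_unbounded: "\<exists>m. B < sum w {..<m}"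
proof (rule ccontr)
  assume "\<not> ?thesis"
  then have "summable w"
    by (intro summableI_nonneg_bounded[where x=B]) (auto simp: w_nonneg not_less)
  then show False using w_nonsum by simp
qed

text \<open>Hardy-Littlewood. Along a greedy enumeration, the weights assigned to the first m
  entries come from at most m distinct positions, so they sum to at most the first m weights; Abel
  summation against the decreasing moduli concludes.\<close>

lemma rearr_bound_norm:
  assumes x: "x \<in> X"
  shows "rearr_bound w x (N x)"
  unfolding rearr_bound_def
proof (intro allI impI)
  fix F :: "nat set" and \<pi> :: "nat \<Rightarrow> nat"
  assume F: "finite F" "inj_on \<pi> F"
  from x have x0: "x \<longlonglongrightarrow> 0" and sm: "summable (\<lambda>n. w n * rearr x n)"
    by (auto simp: lorentz_space_def)
  obtain g where greedy: "greedy x g"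
    by (rule ex_greedy_enumeration[OF x0])
  note g = greedyD[OF greedy]
  note re = rearr_greedy[OF greedy] and dec = decseq_greedy[OF greedy]
  define a where "a n = \<bar>x (g n)\<bar>" for n
  \<comment> \<open>A nonzero entry never chosen would be dominated by infinitely many chosen ones,
    contradicting convergence to 0.\<close>
  have zero: "x k = 0" if "k \<notin> range g" for k
  proof (rule ccontr)
    assume "x k \<noteq> 0"
    then have "\<forall>\<^sub>F n in sequentially. \<bar>x n\<bar> < \<bar>x k\<bar>"
      using x0 by (simp add: tendsto_iff)
    then obtain m where m: "\<And>n. m \<le> n \<Longrightarrow> \<bar>x n\<bar> < \<bar>x k\<bar>"
      by (auto simp: eventually_sequentially)
    have "range g \<subseteq> {..<m}"
    proof
      fix j assume "j \<in> range g"
      then obtain n where "j = g n" by blast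
      moreover have "\<bar>x k\<bar> \<le> \<bar>x (g n)\<bar>" using that by (intro g) auto
      ultimately show "j \<in> {..<m}" using m[of j] by (cases "m \<le> j") auto
    qed
    then show False using g(1) finite_subset range_inj_infinite by blast
  qed
  define J where "J = g -` F"
  have J: "finite J" unfolding J_def using F(1) g(1) by (rule finite_vimageI)
  \<comment> \<open>The assigned weights listed in greedy order, with 0 at indices outside
    \<open>F\<close>.\<close>
  define b where "b n = (if n \<in> J then w (\<pi> (g n)) else 0)" for n
  obtain L where L: "J \<subseteq> {..<L}" using J finite_nat_iff_bounded by blast
  have "(\<Sum>i\<in>F. w (\<pi> i) * \<bar>x i\<bar>) = (\<Sum>i\<in>g ` J. w (\<pi> i) * \<bar>x i\<bar>)"
    by (rule sum.mono_neutral_right) (use F(1) zero in \<open>auto simp: J_def\<close>)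
  also have "\<dots> = (\<Sum>n\<in>J. w (\<pi> (g n)) * a n)"
    using g(1) by (subst sum.reindex) (auto simp: a_def intro: inj_on_subset)
  also have "\<dots> = (\<Sum>n<L. b n * a n)"
    by (rule sum.mono_neutral_cong_left) (use L in \<open>auto simp: b_def\<close>)
  also have "\<dots> \<le> (\<Sum>n<L. w n * a n)"
  proof -
    have part: "0 \<le> sum (\<lambda>n. w n - b n) {..<m}" for m
    proof -
      let ?I = "J \<inter> {..<m}"
      have inj: "inj_on (\<lambda>n. \<pi> (g n)) ?I"
      proof (rule inj_onI)
        fix p q assume "p \<in> ?I" "q \<in> ?I" "\<pi> (g p) = \<pi> (g q)"
        then have "g p = g q" using F(2) by (auto simp: J_def inj_on_def)
        then show "p = q" using g(1) by (simp add: inj_eq)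
      qed
      have "sum b {..<m} = (\<Sum>n\<in>?I. w (\<pi> (g n)))"
        by (rule sum.mono_neutral_cong_right) (auto simp: b_def)
      also have "\<dots> = sum w ((\<lambda>n. \<pi> (g n)) ` ?I)"
        using inj by (subst sum.reindex) auto
      also have "\<dots> \<le> sum w {..<card ((\<lambda>n. \<pi> (g n)) ` ?I)}"
        by (rule sum_le_sum_lessThan_card) (use w_dec in auto)
      also have "\<dots> \<le> sum w {..<m}"
      proof (rule sum_mono2)
        have "card ((\<lambda>n. \<pi> (g n)) ` ?I) \<le> card ?I" by (rule card_image_le) simp
        also have "\<dots> \<le> card {..<m}" by (rule card_mono) auto
        finally show "{..<card ((\<lambda>n. \<pi> (g n)) ` ?I)} \<subseteq> {..<m}" by auto
      qed (auto simp: w_nonneg)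
      finally show ?thesis by (simp add: sum_subtractf)
    qed
    have "0 \<le> a L * sum (\<lambda>n. w n - b n) {..<L}"
      using part by (simp add: a_def)
    also have "\<dots> \<le> (\<Sum>n<L. (w n - b n) * a n)"
      by (rule sum_mult_decseq_ge) (use dec part in \<open>auto simp: a_def\<close>)
    finally show ?thesis by (simp add: left_diff_distrib sum_subtractf)
  qed
  also have "\<dots> = (\<Sum>n<L. w n * rearr x n)" by (simp add: re a_def)
  also have "\<dots> \<le> N x"
    unfolding lorentz_norm_def
    by (rule sum_le_suminf[OF sm]) (auto simp: w_nonneg re)
  finally show "(\<Sum>i\<in>F. w (\<pi> i) * \<bar>x i\<bar>) \<le> N x" .
qed

lemma greedy_sum_le:
  assumes "rearr_bound w x B" "inj g"
  shows "(\<Sum>n<L. w n * \<bar>x (g n)\<bar>) \<le> B"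
proof -
  have "(\<Sum>i\<in>g ` {..<L}. w (inv g i) * \<bar>x i\<bar>) \<le> B"
  proof (rule rearr_boundD[OF assms(1)])
    show "inj_on (inv g) (g ` {..<L})"
      by (rule inj_on_inv_into) auto
  qed simp
  then show ?thesis
    using assms(2) by (subst (asm) sum.reindex) (auto intro: inj_on_subset)
qed

text \<open>If \<open>x\<close> did not tend to 0, infinitely many moduli would be at least some e >
  0, and the unbounded partial sums of \<open>w\<close> would break the bound. Otherwise the greedy
  sums are the partial sums of the norm.\<close>

lemma rearr_bound_imp:
  assumes B: "rearr_bound w x B"
  shows "x \<in> X" "N x \<le> B"
proof -
  have x0: "x \<longlonglongrightarrow> 0"
  proof (rule ccontr)
    assume "\<not> x \<longlonglongrightarrow> 0"
    then obtain e where e: "e > 0" "\<And>n. \<exists>k\<ge>n. e \<le> \<bar>x k\<bar>"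
      unfolding LIMSEQ_iff by (auto simp: not_less)
    have inf: "infinite {k. e \<le> \<bar>x k\<bar>}"
      unfolding infinite_nat_iff_unbounded_le using e(2) by auto
    let ?g = "enumerate {k. e \<le> \<bar>x k\<bar>}"
    obtain m where m: "B / e < sum w {..<m}" using W_unbounded by blast
    have "sum w {..<m} * e = (\<Sum>n<m. w n * e)" by (simp add: sum_distrib_right)
    also have "\<dots> \<le> (\<Sum>n<m. w n * \<bar>x (?g n)\<bar>)"
    proof (rule sum_mono)
      fix n show "w n * e \<le> w n * \<bar>x (?g n)\<bar>"
        using enumerate_in_set[OF inf, of n] by (intro mult_left_mono w_nonneg) simp
    qed
    also have "\<dots> \<le> B"
      by (rule greedy_sum_le[OF B strict_mono_imp_inj_on[OF strict_mono_enumerate[OF inf]]])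
    finally show False using m e(1) by (simp add: field_simps)
  qed
  obtain g where greedy: "greedy x g"
    by (rule ex_greedy_enumeration[OF x0])
  note g = greedyD[OF greedy]
  have le: "(\<Sum>n<m. w n * rearr x n) \<le> B" for m
    using greedy_sum_le[OF B g(1)] by (simp add: rearr_greedy[OF greedy])
  have sm: "summable (\<lambda>n. w n * rearr x n)"
    by (rule summableI_nonneg_bounded[OF _ le]) (simp add: w_nonneg rearr_greedy[OF greedy])
  show "x \<in> X" using x0 sm by (simp add: lorentz_space_def)
  show "N x \<le> B"
    unfolding lorentz_norm_def by (rule suminf_le_const[OF sm le])
qed

section \<open>Norm, lattice and projection estimates\<close>

lemma norm_nonneg: "x \<in> X \<Longrightarrow> 0 \<le> N x"
  using rearr_boundD[OF rearr_bound_norm, of x "{}" id] by simp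

lemma rearr_bound_lin:
  assumes "rearr_bound w x B" "rearr_bound w y C"
  shows "rearr_bound w (\<lambda>k. a * x k + b * y k) (\<bar>a\<bar> * B + \<bar>b\<bar> * C)"
  unfolding rearr_bound_def
proof (intro allI impI)
  fix F :: "nat set" and \<pi> :: "nat \<Rightarrow> nat"
  assume F: "finite F" "inj_on \<pi> F"
  have "(\<Sum>i\<in>F. w (\<pi> i) * \<bar>a * x i + b * y i\<bar>)
      \<le> (\<Sum>i\<in>F. \<bar>a\<bar> * (w (\<pi> i) * \<bar>x i\<bar>) + \<bar>b\<bar> * (w (\<pi> i) * \<bar>y i\<bar>))"
  proof (rule sum_mono)
    fix i
    have "w (\<pi> i) * \<bar>a * x i + b * y i\<bar> \<le> w (\<pi> i) * (\<bar>a\<bar> * \<bar>x i\<bar> + \<bar>b\<bar> * \<bar>y i\<bar>)"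
      by (intro mult_left_mono w_nonneg) (metis abs_mult abs_triangle_ineq)
    then show "w (\<pi> i) * \<bar>a * x i + b * y i\<bar>
        \<le> \<bar>a\<bar> * (w (\<pi> i) * \<bar>x i\<bar>) + \<bar>b\<bar> * (w (\<pi> i) * \<bar>y i\<bar>)"
      by (simp add: algebra_simps)
  qed
  also have "\<dots> = \<bar>a\<bar> * (\<Sum>i\<in>F. w (\<pi> i) * \<bar>x i\<bar>) + \<bar>b\<bar> * (\<Sum>i\<in>F. w (\<pi> i) * \<bar>y i\<bar>)"
    by (simp add: sum.distrib sum_distrib_left)
  also have "\<dots> \<le> \<bar>a\<bar> * B + \<bar>b\<bar> * C"
    by (intro add_mono mult_left_mono rearr_boundD[OF assms(1) F] rearr_boundD[OF assms(2) F]) auto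
  finally show "(\<Sum>i\<in>F. w (\<pi> i) * \<bar>a * x i + b * y i\<bar>) \<le> \<bar>a\<bar> * B + \<bar>b\<bar> * C" .
qed

lemma
  assumes "x \<in> X" "y \<in> X"
  shows lin_in: "(\<lambda>k. a * x k + b * y k) \<in> X"
    and norm_lin: "N (\<lambda>k. a * x k + b * y k) \<le> \<bar>a\<bar> * N x + \<bar>b\<bar> * N y"
  using rearr_bound_imp[OF rearr_bound_lin[OF rearr_bound_norm[OF assms(1)] rearr_bound_norm[OF assms(2)], of a b]]
  by auto

lemma
  assumes "y \<in> X" "\<And>i. \<bar>x i\<bar> \<le> \<bar>y i\<bar>"
  shows mono_in: "x \<in> X" and norm_mono: "N x \<le> N y"
proof -
  have "rearr_bound w x (N y)"
    unfolding rearr_bound_def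
  proof (intro allI impI)
    fix F :: "nat set" and \<pi> :: "nat \<Rightarrow> nat"
    assume F: "finite F" "inj_on \<pi> F"
    have "(\<Sum>i\<in>F. w (\<pi> i) * \<bar>x i\<bar>) \<le> (\<Sum>i\<in>F. w (\<pi> i) * \<bar>y i\<bar>)"
      by (intro sum_mono mult_left_mono w_nonneg assms)
    then show "(\<Sum>i\<in>F. w (\<pi> i) * \<bar>x i\<bar>) \<le> N y"
      using rearr_boundD[OF rearr_bound_norm[OF assms(1)] F] by simp
  qed
  then show "x \<in> X" "N x \<le> N y" by (auto dest: rearr_bound_imp)
qed

lemma zero_in: "(\<lambda>k. 0) \<in> X" and norm_zero: "N (\<lambda>k. 0) = 0"
proof -
  have "rearr_bound w (\<lambda>k. 0) 0" by (simp add: rearr_bound_def)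
  from rearr_bound_imp[OF this] show "(\<lambda>k. 0) \<in> X" "N (\<lambda>k. 0) = 0"
    using norm_nonneg by (auto intro: antisym)
qed

lemma scale_in: "x \<in> X \<Longrightarrow> (\<lambda>k. a * x k) \<in> X"
  using lin_in[of x x a 0] by simp

lemma norm_scale:
  assumes "x \<in> X"
  shows "N (\<lambda>k. a * x k) = \<bar>a\<bar> * N x"
proof (cases "a = 0")
  case True
  then show ?thesis by (simp add: norm_zero)
next
  case False
  have le: "N (\<lambda>k. c * y k) \<le> \<bar>c\<bar> * N y" if "y \<in> X" for c y
    using norm_lin[OF that that, of c 0] by simp
  have "N x \<le> \<bar>inverse a\<bar> * N (\<lambda>k. a * x k)"
    using le[OF scale_in[OF assms, of a], of "inverse a"] False by (simp add: mult.assoc[symmetric])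
  then have "\<bar>a\<bar> * N x \<le> N (\<lambda>k. a * x k)"
    using False by (simp add: field_simps)
  then show ?thesis using le[OF assms, of a] by simp
qed

lemma diff_in: "x \<in> X \<Longrightarrow> y \<in> X \<Longrightarrow> (\<lambda>k. x k - y k) \<in> X"
  using lin_in[of x y 1 "-1"] by simp

lemma norm_diff: "x \<in> X \<Longrightarrow> y \<in> X \<Longrightarrow> N (\<lambda>k. x k - y k) \<le> N x + N y"
  using norm_lin[of x y 1 "-1"] by simp

lemma norm_triangle_sub: "x \<in> X \<Longrightarrow> y \<in> X \<Longrightarrow> N x \<le> N y + N (\<lambda>k. x k - y k)"
  using norm_lin[of y "\<lambda>k. x k - y k" 1 1] diff_in[of x y] by simp

lemma norm_minus_commute: "x \<in> X \<Longrightarrow> y \<in> X \<Longrightarrow> N (\<lambda>k. x k - y k) = N (\<lambda>k. y k - x k)"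
  using norm_scale[OF diff_in, of y x "-1"] by simp

lemma
  fixes n :: nat
  assumes "\<And>i. i < n \<Longrightarrow> v i \<in> X"
  shows sum_in: "(\<lambda>k. \<Sum>i<n. c i * v i k) \<in> X"
    and norm_sum: "N (\<lambda>k. \<Sum>i<n. c i * v i k) \<le> (\<Sum>i<n. \<bar>c i\<bar> * N (v i))"
proof -
  have "(\<lambda>k. \<Sum>i<n. c i * v i k) \<in> X \<and>
      N (\<lambda>k. \<Sum>i<n. c i * v i k) \<le> (\<Sum>i<n. \<bar>c i\<bar> * N (v i))"
    using assms
  proof (induction n)
    case 0
    then show ?case by (simp add: zero_in norm_zero)
  next
    case (Suc n)
    then have "(\<lambda>k. \<Sum>i<n. c i * v i k) \<in> X" "v n \<in> X"
      "N (\<lambda>k. \<Sum>i<n. c i * v i k) \<le> (\<Sum>i<n. \<bar>c i\<bar> * N (v i))" by simp_all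
    with lin_in[OF this(1,2), of 1 "c n"] norm_lin[OF this(1,2), of 1 "c n"]
    show ?case by simp
  qed
  then show "(\<lambda>k. \<Sum>i<n. c i * v i k) \<in> X"
    "N (\<lambda>k. \<Sum>i<n. c i * v i k) \<le> (\<Sum>i<n. \<bar>c i\<bar> * N (v i))" by auto
qed

text \<open>A single index may receive the largest weight, \<open>w 0 = 1\<close>.\<close>

lemma abs_le_norm: "x \<in> X \<Longrightarrow> \<bar>x i\<bar> \<le> N x"
  using rearr_boundD[OF rearr_bound_norm, of x "{i}" "\<lambda>_. 0"] w0 by simp

lemma proj_in: "x \<in> X \<Longrightarrow> proj A x \<in> X"
  by (auto simp: proj_def intro!: mono_in[of x])

lemma norm_proj_mono: "x \<in> X \<Longrightarrow> A \<subseteq> B \<Longrightarrow> N (proj A x) \<le> N (proj B x)"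
  by (rule norm_mono[OF proj_in]) (auto simp: proj_def)

lemma
  assumes "finite A"
  shows finite_proj_in: "proj A x \<in> X"
    and norm_finite_proj: "N (proj A x) \<le> (\<Sum>i\<in>A. \<bar>x i\<bar>)"
proof -
  have "rearr_bound w (proj A x) (\<Sum>i\<in>A. \<bar>x i\<bar>)"
    unfolding rearr_bound_def
  proof (intro allI impI)
    fix F :: "nat set" and \<pi> :: "nat \<Rightarrow> nat"
    assume F: "finite F" "inj_on \<pi> F"
    have "(\<Sum>i\<in>F. w (\<pi> i) * \<bar>proj A x i\<bar>) \<le> (\<Sum>i\<in>F. 1 * \<bar>proj A x i\<bar>)"
      by (intro sum_mono mult_right_mono w_le1) auto
    also have "\<dots> = (\<Sum>i\<in>F \<inter> A. \<bar>x i\<bar>)"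
      using F(1) by (intro sum.mono_neutral_cong_right) (auto simp: proj_def)
    also have "\<dots> \<le> (\<Sum>i\<in>A. \<bar>x i\<bar>)"
      using assms by (intro sum_mono2) auto
    finally show "(\<Sum>i\<in>F. w (\<pi> i) * \<bar>proj A x i\<bar>) \<le> (\<Sum>i\<in>A. \<bar>x i\<bar>)" .
  qed
  then show "proj A x \<in> X" "N (proj A x) \<le> (\<Sum>i\<in>A. \<bar>x i\<bar>)"
    by (auto dest: rearr_bound_imp)
qed

section \<open>Decay of tails\<close>

lemma norm_greedy:
  assumes x: "x \<in> X"
  obtains g :: "nat \<Rightarrow> nat" where "inj g" "decseq (\<lambda>n. \<bar>x (g n)\<bar>)" "(\<lambda>n. w n * \<bar>x (g n)\<bar>) sums N x"
proof -
  from x have x0: "x \<longlonglongrightarrow> 0" and sm: "summable (\<lambda>n. w n * rearr x n)"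
    by (auto simp: lorentz_space_def)
  obtain g where greedy: "greedy x g"
    by (rule ex_greedy_enumeration[OF x0])
  note g = greedyD[OF greedy]
  show ?thesis
    using that[OF g(1) decseq_greedy[OF greedy]] summable_sums[OF sm]
    by (simp add: rearr_greedy[OF greedy] lorentz_norm_def)
qed

text \<open>Let the first \<open>L\<close> greedy terms carry all but e / 2 of the norm. Far out,
  fewer than L + 1 entries get a weight with index below \<open>L\<close>, and these entries are
  tiny; the entries with later weights can be joined to the greedy terms without a clash, so they
  contribute at most e / 2.\<close>

lemma norm_tail:
  assumes x: "x \<in> X" and e: "e > 0"
  obtains q where "N (proj {q..} x) \<le> e"
proof -
  obtain g :: "nat \<Rightarrow> nat" where g: "inj g" "(\<lambda>n. w n * \<bar>x (g n)\<bar>) sums N x"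
    by (rule norm_greedy[OF x])
  have "\<forall>\<^sub>F L in sequentially. N x - e / 2 < (\<Sum>n<L. w n * \<bar>x (g n)\<bar>)"
    using g(2) e unfolding sums_def by (intro order_tendstoD) auto
  then obtain L where L: "N x - e / 2 < (\<Sum>n<L. w n * \<bar>x (g n)\<bar>)"
    by (auto simp: eventually_sequentially)
  have "x \<longlonglongrightarrow> 0" using x by (simp add: lorentz_space_def)
  \<comment> \<open>At this level, \<open>L\<close> entries with weights at most 1 contribute at
    most e / 2; the summand 1 covers \<open>L = 0\<close>.\<close>
  moreover have "e / (2 * (real L + 1)) > 0" using e by simp
  ultimately have "\<forall>\<^sub>F n in sequentially. \<bar>x n\<bar> < e / (2 * (real L + 1))"
    using tendstoD[of x 0 sequentially] by (simp add: dist_real_def)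
  then obtain r where r: "\<And>n. r \<le> n \<Longrightarrow> \<bar>x n\<bar> < e / (2 * (real L + 1))"
    by (auto simp: eventually_sequentially)
  define q where "q = Suc (r + Max (insert 0 (g ` {..<L})))"
  have gq: "g n < q" if "n < L" for n
  proof -
    have "g n \<le> Max (insert 0 (g ` {..<L}))" by (rule Max_ge) (use that in auto)
    then show ?thesis unfolding q_def by linarith
  qed
  have "rearr_bound w (proj {q..} x) e"
    unfolding rearr_bound_def
  proof (intro allI impI)
    fix F :: "nat set" and \<pi> :: "nat \<Rightarrow> nat"
    assume F: "finite F" "inj_on \<pi> F"
    define H where "H = {i \<in> F. q \<le> i \<and> \<pi> i < L}"
    define G where "G = {i \<in> F. q \<le> i \<and> L \<le> \<pi> i}"
    define G0 where "G0 = g ` {..<L}"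
    have fin: "finite H" "finite G" "finite G0" using F(1) by (auto simp: H_def G_def G0_def)
    have "(\<Sum>i\<in>H. w (\<pi> i) * \<bar>x i\<bar>) \<le> (\<Sum>i\<in>H. 1 * (e / (2 * (real L + 1))))"
    proof (intro sum_mono mult_mono w_le1)
      fix i assume "i \<in> H"
      then have "r \<le> i" by (simp add: H_def q_def)
      then show "\<bar>x i\<bar> \<le> e / (2 * (real L + 1))" using r by (simp add: less_imp_le)
    qed auto
    also have "\<dots> = real (card H) * (e / (2 * (real L + 1)))" by simp
    also have "\<dots> \<le> (real L + 1) * (e / (2 * (real L + 1)))"
    proof (rule mult_right_mono)
      have "card H = card (\<pi> ` H)"
        by (rule card_image[symmetric], rule inj_on_subset[OF F(2)]) (auto simp: H_def)
      also have "\<dots> \<le> card {..<L}"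
        by (rule card_mono) (auto simp: H_def)
      finally show "real (card H) \<le> real L + 1" by simp
    qed (use e in simp)
    also have "\<dots> = e / 2" by (simp add: field_simps)
    finally have sH: "(\<Sum>i\<in>H. w (\<pi> i) * \<bar>x i\<bar>) \<le> e / 2" .
    have disj: "G0 \<inter> G = {}" using gq by (fastforce simp: G0_def G_def)
    \<comment> \<open>Weights below \<open>L\<close> go to the greedy indices, weights from
      \<open>L\<close> on to \<open>G\<close>, so the two assignments combine injectively.\<close>
    define \<rho> where "\<rho> i = (if i \<in> G0 then inv g i else \<pi> i)" for i
    have rho_g: "\<rho> (g n) = n" if "n < L" for n
      using that g(1) by (simp add: \<rho>_def G0_def)
    have rho_G: "\<rho> i = \<pi> i" if "i \<in> G" for i
      using that disj by (auto simp: \<rho>_def)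
    have "inj_on \<rho> (G0 \<union> G)"
    proof (rule inj_onI)
      fix i j assume ij: "i \<in> G0 \<union> G" "j \<in> G0 \<union> G" "\<rho> i = \<rho> j"
      have *: "\<rho> k < L \<longleftrightarrow> k \<in> G0" if "k \<in> G0 \<union> G" for k
        using that rho_g rho_G disj by (fastforce simp: G0_def G_def)
      show "i = j"
      proof (cases "i \<in> G0")
        case True
        then have "j \<in> G0" using * ij by metis
        with True ij(3) rho_g show ?thesis by (auto simp: G0_def)
      next
        case False
        then have "j \<notin> G0" using * ij by metis
        with False ij rho_G have "i \<in> G" "j \<in> G" "\<pi> i = \<pi> j" by auto
        then show ?thesis using F(2) by (auto simp: G_def inj_on_def)
      qed
    qed
    then have "(\<Sum>i\<in>G0 \<union> G. w (\<rho> i) * \<bar>x i\<bar>) \<le> N x"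
      using fin by (intro rearr_boundD[OF rearr_bound_norm[OF x]]) auto
    moreover have "(\<Sum>i\<in>G0 \<union> G. w (\<rho> i) * \<bar>x i\<bar>)
        = (\<Sum>i\<in>G0. w (\<rho> i) * \<bar>x i\<bar>) + (\<Sum>i\<in>G. w (\<rho> i) * \<bar>x i\<bar>)"
      by (rule sum.union_disjoint) (use fin disj in auto)
    moreover have "(\<Sum>i\<in>G0. w (\<rho> i) * \<bar>x i\<bar>) = (\<Sum>n<L. w n * \<bar>x (g n)\<bar>)"
      unfolding G0_def using g(1) rho_g by (subst sum.reindex) (auto intro: inj_on_subset)
    moreover have "(\<Sum>i\<in>G. w (\<rho> i) * \<bar>x i\<bar>) = (\<Sum>i\<in>G. w (\<pi> i) * \<bar>x i\<bar>)"
      using rho_G by simp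
    ultimately have sG: "(\<Sum>i\<in>G. w (\<pi> i) * \<bar>x i\<bar>) \<le> e / 2" using L by linarith
    have "(\<Sum>i\<in>F. w (\<pi> i) * \<bar>proj {q..} x i\<bar>) = (\<Sum>i\<in>H \<union> G. w (\<pi> i) * \<bar>x i\<bar>)"
      by (rule sum.mono_neutral_cong_right) (use F(1) in \<open>auto simp: proj_def H_def G_def\<close>)
    also have "\<dots> = (\<Sum>i\<in>H. w (\<pi> i) * \<bar>x i\<bar>) + (\<Sum>i\<in>G. w (\<pi> i) * \<bar>x i\<bar>)"
      by (rule sum.union_disjoint) (use fin in \<open>auto simp: H_def G_def\<close>)
    also have "\<dots> \<le> e" using sH sG by linarith
    finally show "(\<Sum>i\<in>F. w (\<pi> i) * \<bar>proj {q..} x i\<bar>) \<le> e" .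
  qed
  then show ?thesis using rearr_bound_imp that by blast
qed

section \<open>Weak compactness\<close>

lemma dual_linear:
  assumes "f \<in> lorentz_dual w" "x \<in> X" "y \<in> X"
  shows "f (\<lambda>k. a * x k + b * y k) = a * f x + b * f y"
  using assms by (auto simp: lorentz_dual_def)

text \<open>The constant is made positive so that one can divide by it.\<close>

lemma dual_bound:
  assumes "f \<in> lorentz_dual w"
  obtains C where "C > 0" "\<And>x. x \<in> X \<Longrightarrow> \<bar>f x\<bar> \<le> C * N x"
proof -
  obtain C where C: "\<And>x. x \<in> X \<Longrightarrow> \<bar>f x\<bar> \<le> C * N x"
    using assms unfolding lorentz_dual_def by blast
  have "\<bar>f x\<bar> \<le> max C 1 * N x" if "x \<in> X" for x
    using C[OF that] norm_nonneg[OF that] by (meson max.cobounded1 mult_right_mono order_trans)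
  then show ?thesis by (intro that[of "max C 1"]) auto
qed

lemma dual_zero: "f \<in> lorentz_dual w \<Longrightarrow> f (\<lambda>k. 0) = 0"
  using dual_linear[of f "\<lambda>k. 0" "\<lambda>k. 0" 0 0] zero_in by simp

lemma dual_sum:
  assumes f: "f \<in> lorentz_dual w" and "\<And>i::nat. i < n \<Longrightarrow> v i \<in> X"
  shows "f (\<lambda>k. \<Sum>i<n. c i * v i k) = (\<Sum>i<n. c i * f (v i))"
  using assms(2)
proof (induction n)
  case 0
  then show ?case using dual_zero[OF f] by simp
next
  case (Suc n)
  have "f (\<lambda>k. 1 * (\<Sum>i<n. c i * v i k) + c n * v n k) = 1 * f (\<lambda>k. \<Sum>i<n. c i * v i k) + c n * f (v n)"
    by (rule dual_linear[OF f]) (use Suc.prems in \<open>auto intro!: sum_in\<close>)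
  then show ?case using Suc by simp
qed

text \<open>Here \<open>proj {i} (\<lambda>_. 1)\<close> is the i-th unit vector. The formula shows
  that a functional restricted to a finite block is continuous for coordinatewise
  convergence.\<close>

lemma dual_finite_proj:
  assumes f: "f \<in> lorentz_dual w" and A: "finite A"
  shows "f (proj A x) = (\<Sum>i\<in>A. x i * f (proj {i} (\<lambda>_. 1)))"
  using A
proof (induction A)
  case empty
  then show ?case using dual_zero[OF f] by (simp add: proj_def)
next
  case (insert a A)
  have "proj (insert a A) x = (\<lambda>k. 1 * proj A x k + x a * proj {a} (\<lambda>_. 1) k)"
    using insert by (auto simp: proj_def)
  then have "f (proj (insert a A) x) = 1 * f (proj A x) + x a * f (proj {a} (\<lambda>_. 1))"
    using dual_linear[OF f finite_proj_in[OF insert(1), of x] finite_proj_in[of "{a}" "\<lambda>_. 1"], of 1 "x a"]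
    by simp
  then show ?case using insert by simp
qed

section \<open>The weak topology\<close>

lemma coordinate_dual: "(\<lambda>x. x i) \<in> lorentz_dual w"
  unfolding lorentz_dual_def using abs_le_norm by (auto intro!: exI[of _ 1])

lemma zero_dual: "(\<lambda>x. 0) \<in> lorentz_dual w"
  unfolding lorentz_dual_def by (auto intro!: exI[of _ 0])

lemma topspace_weak_top: "topspace (weak_top w) = X"
proof -
  have "{x \<in> X. (0::real) \<in> UNIV} \<in> {{x \<in> X. f x \<in> U} | f U. f \<in> lorentz_dual w \<and> open U}"
    using zero_dual by blast
  then show ?thesis
    unfolding weak_top_def topology_generated_by_topspace by auto
qed

lemma openin_weak_top: "f \<in> lorentz_dual w \<Longrightarrow> open U \<Longrightarrow> openin (weak_top w) {x \<in> X. f x \<in> U}"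
  unfolding weak_top_def by (rule topology_generated_by_Basis) blast

lemma compact_bounded_functions: "compact (PiE UNIV (\<lambda>_. {- B..B}) :: (nat \<Rightarrow> real) set)"
proof -
  have "compactin (product_topology (\<lambda>i. euclidean) UNIV) (PiE UNIV (\<lambda>_. {- B..B}) :: (nat \<Rightarrow> real) set)"
    by (subst compactin_PiE) auto
  then show ?thesis by (simp add: euclidean_product_topology)
qed

text \<open>The coordinatewise closure of S is compact by Tychonoff, and on it every functional is a
  uniform limit of functionals depending on finitely many coordinates, so that the weak topology
  coincides there with the coordinatewise one.\<close>
lemma weak_closure_compact:
  assumes S: "\<And>y. y \<in> S \<Longrightarrow> y \<in> X" "\<And>y. y \<in> S \<Longrightarrow> N y \<le> B"
    and tails: "\<And>f e. f \<in> lorentz_dual w \<Longrightarrow> e > 0 \<Longrightarrow>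
      \<exists>n. \<forall>m\<ge>n. \<forall>q. \<forall>y\<in>S. \<bar>f (proj {m..<q} y)\<bar> \<le> e"
  shows "compactin (weak_top w) (weak_top w closure_of S)"
proof -
  have coord: "continuous_on A (\<lambda>x :: nat \<Rightarrow> real. x i)" for A i
    by (rule continuous_on_subset[OF continuous_on_product_coordinates subset_UNIV])
  define K where "K = closure S"
  have SK: "S \<subseteq> K" unfolding K_def by (rule closure_subset)
  have "K \<subseteq> PiE UNIV (\<lambda>_. {- B..B})"
    unfolding K_def
  proof (rule closure_minimal)
    show "S \<subseteq> PiE UNIV (\<lambda>_. {- B..B})"
    proof
      fix y assume "y \<in> S"
      then have "\<bar>y i\<bar> \<le> B" for i using S abs_le_norm order_trans by blast
      then show "y \<in> PiE UNIV (\<lambda>_. {- B..B})" by (simp add: PiE_UNIV_domain abs_le_iff minus_le_iff)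
    qed
  qed (rule compact_imp_closed[OF compact_bounded_functions])
  then have K: "compact K"
    unfolding K_def using compact_Int_closed[OF compact_bounded_functions closed_closure]
    by (metis inf.absorb2)
  \<comment> \<open>Fatou property: each finite weighted sum is continuous in the coordinates, so
    its bound passes to the closure.\<close>
  have KX: "K \<subseteq> X"
  proof
    fix x assume x: "x \<in> K"
    have "rearr_bound w x B"
      unfolding rearr_bound_def
    proof (intro allI impI)
      fix F :: "nat set" and \<pi> :: "nat \<Rightarrow> nat"
      assume F: "finite F" "inj_on \<pi> F"
      have "K \<subseteq> {x. (\<Sum>i\<in>F. w (\<pi> i) * \<bar>x i\<bar>) \<le> B}"
        unfolding K_def
      proof (rule closure_minimal)
        show "S \<subseteq> {x. (\<Sum>i\<in>F. w (\<pi> i) * \<bar>x i\<bar>) \<le> B}"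
          using S rearr_boundD[OF rearr_bound_norm F] order_trans by blast
        show "closed {x. (\<Sum>i\<in>F. w (\<pi> i) * \<bar>x i\<bar>) \<le> B}"
          by (intro closed_Collect_le continuous_on_rabs continuous_on_sum continuous_on_mult
              continuous_on_const coord)
      qed
      then show "(\<Sum>i\<in>F. w (\<pi> i) * \<bar>x i\<bar>) \<le> B" using x by auto
    qed
    then show "x \<in> X" by (rule rearr_bound_imp)
  qed
  have cont: "continuous_on K f" if f: "f \<in> lorentz_dual w" for f
  proof (rule uniform_limit_theorem)
    show "\<forall>\<^sub>F m in sequentially. continuous_on K (\<lambda>x. f (proj {..<m} x))"
      unfolding dual_finite_proj[OF f finite_lessThan]
      by (intro always_eventually allI continuous_on_sum continuous_on_mult continuous_on_const coord)
    obtain C where C: "C > 0" "\<And>x. x \<in> X \<Longrightarrow> \<bar>f x\<bar> \<le> C * N x"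
      by (rule dual_bound[OF f]) blast
    show "uniform_limit K (\<lambda>m x. f (proj {..<m} x)) f sequentially"
    proof (rule uniform_limitI)
      fix e :: real assume e: "e > 0"
      obtain n where n: "\<And>m q y. m \<ge> n \<Longrightarrow> y \<in> S \<Longrightarrow> \<bar>f (proj {m..<q} y)\<bar> \<le> e / 3"
        using tails[OF f, of "e / 3"] e by auto
      \<comment> \<open>Block values are finite combinations of coordinates, so their uniform
        smallness passes from \<open>S\<close> to its closure.\<close>
      have nK: "\<bar>f (proj {m..<q} y)\<bar> \<le> e / 3" if "m \<ge> n" "y \<in> K" for m q y
      proof -
        have "K \<subseteq> {y. \<bar>f (proj {m..<q} y)\<bar> \<le> e / 3}"
          unfolding K_def
        proof (rule closure_minimal)
          show "closed {y. \<bar>f (proj {m..<q} y)\<bar> \<le> e / 3}"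
            unfolding dual_finite_proj[OF f finite_atLeastLessThan]
            by (intro closed_Collect_le continuous_on_rabs continuous_on_sum continuous_on_mult
                continuous_on_const coord)
        qed (use n that in auto)
        then show ?thesis using that by auto
      qed
      have "dist (f (proj {..<m} x)) (f x) < e" if m: "m \<ge> n" and x: "x \<in> K" for m x
      proof -
        have xX: "x \<in> X" using x KX by auto
        obtain p where p: "N (proj {p..} x) \<le> e / (3 * C)"
          by (rule norm_tail[OF xX, of "e / (3 * C)"]) (use e C in auto)
        define q where "q = max m p"
        have "N (proj {q..} x) \<le> N (proj {p..} x)"
          by (rule norm_proj_mono[OF xX]) (auto simp: q_def)
        then have "C * N (proj {q..} x) \<le> C * (e / (3 * C))"
          using p C by (intro mult_left_mono) auto
        then have tl: "\<bar>f (proj {q..} x)\<bar> \<le> e / 3"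
          using C(2)[OF proj_in[OF xX, of "{q..}"]] C(1) by simp
        \<comment> \<open>The head is the approximation; the block is small uniformly on
          \<open>K\<close>, and the tail is small because \<open>q\<close> was chosen for this
          particular \<open>x\<close>.\<close>
        have "x = (\<lambda>k. 1 * proj {..<m} x k + 1 * (1 * proj {m..<q} x k + 1 * proj {q..} x k))"
          by (rule ext) (auto simp: proj_def q_def)
        then have "f x = f (\<lambda>k. 1 * proj {..<m} x k + 1 * (1 * proj {m..<q} x k + 1 * proj {q..} x k))"
          by simp
        also have "\<dots> = f (proj {..<m} x) + (f (proj {m..<q} x) + f (proj {q..} x))"
          using xX by (simp only: dual_linear[OF f] proj_in lin_in) simp
        finally show ?thesis
          using tl nK[OF m x, of q] e by (simp add: dist_real_def)
      qed
      then show "\<forall>\<^sub>F m in sequentially. \<forall>x\<in>K. dist (f (proj {..<m} x)) (f x) < e"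
        by (auto simp: eventually_sequentially)
    qed
  qed simp
  \<comment> \<open>The identity from the coordinatewise to the weak topology is continuous on
    \<open>K\<close>, so compactness carries over.\<close>
  have "continuous_map (top_of_set K) (weak_top w) id"
    unfolding weak_top_def
  proof (rule continuous_on_generated_topo)
    fix U assume "U \<in> {{x \<in> X. f x \<in> V} | f V. f \<in> lorentz_dual w \<and> open V}"
    then obtain f V where fV: "U = {x \<in> X. f x \<in> V}" "f \<in> lorentz_dual w" "open V" by blast
    have "id -` U \<inter> topspace (top_of_set K) = K \<inter> f -` V" using KX fV by auto
    moreover have "openin (top_of_set K) (K \<inter> f -` V)"
      by (rule continuous_openin_preimage_gen[OF cont fV(3)]) (rule fV)
    ultimately show "openin (top_of_set K) (id -` U \<inter> topspace (top_of_set K))" by simp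
  next
    show "id ` topspace (top_of_set K) \<subseteq> \<Union> {{x \<in> X. f x \<in> V} | f V. f \<in> lorentz_dual w \<and> open V}"
      using topspace_weak_top KX unfolding weak_top_def topology_generated_by_topspace by simp
  qed
  moreover have "compactin (top_of_set K) K" using K by simp
  ultimately have KC: "compactin (weak_top w) K"
    using image_compactin[of "top_of_set K" K "weak_top w" id] by simp
  \<comment> \<open>Coordinates are functionals, so the weak topology refines the coordinatewise one
    and \<open>K\<close> is weakly closed.\<close>
  have "continuous_map (weak_top w) euclidean (\<lambda>x. x)"
    unfolding euclidean_product_topology[symmetric] continuous_map_componentwise_UNIV
  proof
    fix k
    show "continuous_map (weak_top w) euclidean (\<lambda>x. x k)"
      unfolding continuous_map_def topspace_weak_top
      using openin_weak_top[OF coordinate_dual, of _ k] by simp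
  qed
  then have "closedin (weak_top w) {x \<in> topspace (weak_top w). x \<in> K}"
    by (rule closedin_continuous_map_preimage) (simp add: K_def)
  moreover have "{x \<in> topspace (weak_top w). x \<in> K} = K"
    using KX by (auto simp: topspace_weak_top)
  ultimately have "closedin (weak_top w) K" by simp
  then have "weak_top w closure_of S \<subseteq> K" by (rule closure_of_minimal[OF SK])
  then show ?thesis by (intro closed_compactin[OF KC]) auto
qed

section \<open>Operators fixing a copy of $\ell_1$\<close>

lemma op_in: "bounded_op w T \<Longrightarrow> x \<in> X \<Longrightarrow> T x \<in> X"
  by (simp add: bounded_op_def)

lemma op_linear:
  assumes "bounded_op w T" "x \<in> X" "y \<in> X"
  shows "T (\<lambda>k. a * x k + b * y k) = (\<lambda>k. a * T x k + b * T y k)"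
  using assms by (auto simp: bounded_op_def)

lemma op_bound:
  assumes "bounded_op w T"
  obtains C where "C > 0" "\<And>x. x \<in> X \<Longrightarrow> N (T x) \<le> C * N x"
proof -
  obtain C where C: "\<And>x. x \<in> X \<Longrightarrow> N (T x) \<le> C * N x"
    using assms unfolding bounded_op_def by blast
  have "N (T x) \<le> max C 1 * N x" if "x \<in> X" for x
    using C[OF that] norm_nonneg[OF that] by (meson max.cobounded1 mult_right_mono order_trans)
  then show ?thesis by (intro that[of "max C 1"]) auto
qed

lemma op_zero: "bounded_op w T \<Longrightarrow> T (\<lambda>k. 0) = (\<lambda>k. 0)"
  using op_linear[of T "\<lambda>k. 0" "\<lambda>k. 0" 0 0] zero_in by simp

lemma op_sum:
  assumes T: "bounded_op w T" and "\<And>i::nat. i < n \<Longrightarrow> v i \<in> X"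
  shows "T (\<lambda>k. \<Sum>i<n. c i * v i k) = (\<lambda>k. \<Sum>i<n. c i * T (v i) k)"
  using assms(2)
proof (induction n)
  case 0
  then show ?case using op_zero[OF T] by simp
next
  case (Suc n)
  have "T (\<lambda>k. 1 * (\<Sum>i<n. c i * v i k) + c n * v n k)
      = (\<lambda>k. 1 * T (\<lambda>k. \<Sum>i<n. c i * v i k) k + c n * T (v n) k)"
    by (rule op_linear[OF T]) (use Suc.prems in \<open>auto intro!: sum_in\<close>)
  then show ?case using Suc by simp
qed

lemma op_diff:
  "bounded_op w T \<Longrightarrow> x \<in> X \<Longrightarrow> y \<in> X \<Longrightarrow> T (\<lambda>k. x k - y k) = (\<lambda>k. T x k - T y k)"
  using op_linear[of T x y 1 "-1"] by simp

text \<open>The span of the x j is isomorphic to $\ell_1$; its closure witnesses the failure of strict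
  singularity.\<close>
lemma not_strictly_singularI:
  assumes T: "bounded_op w T"
    and x: "\<And>j::nat. x j \<in> X" "\<And>j. N (x j) \<le> B"
    and "c > 0"
    and lower: "\<And>a n. c * (\<Sum>j<n. \<bar>a j\<bar>) \<le> N (\<lambda>k. \<Sum>j<n. a j * T (x j) k)"
  shows "\<not> strictly_singular w T"
proof -
  define S where "S = {(\<lambda>k. \<Sum>j<n. a j * x j k) | n a. True}"
  define M where "M = {y \<in> X. \<forall>e>0. \<exists>s\<in>S. N (\<lambda>k. s k - y k) < e}"
  have SX: "S \<subseteq> X" unfolding S_def using x(1) sum_in by blast
  have in_S: "(\<lambda>k. \<Sum>j<m. d j * x j k) \<in> S" for m d unfolding S_def by blast
  have S_lin: "(\<lambda>k. a * s k + b * t k) \<in> S" if "s \<in> S" "t \<in> S" for a b s t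
  proof -
    obtain n c where s: "s = (\<lambda>k. \<Sum>j<n. c j * x j k)" using \<open>s \<in> S\<close> unfolding S_def by blast
    obtain m d where t: "t = (\<lambda>k. \<Sum>j<m. d j * x j k)" using \<open>t \<in> S\<close> unfolding S_def by blast
    \<comment> \<open>Both combinations are padded with zero coefficients to a common
      length.\<close>
    let ?e = "\<lambda>j. a * (if j < n then c j else 0) + b * (if j < m then d j else 0)"
    have "(\<Sum>j<max n m. ?e j * x j k) = a * s k + b * t k" for k
    proof -
      have "(\<Sum>j<max n m. ?e j * x j k) = a * (\<Sum>j<max n m. (if j < n then c j else 0) * x j k)
          + b * (\<Sum>j<max n m. (if j < m then d j else 0) * x j k)"
        by (simp add: sum_distrib_left sum.distrib algebra_simps)
      also have "(\<Sum>j<max n m. (if j < n then c j else 0) * x j k) = s k"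
        unfolding s by (rule sum.mono_neutral_cong_right) auto
      also have "(\<Sum>j<max n m. (if j < m then d j else 0) * x j k) = t k"
        unfolding t by (rule sum.mono_neutral_cong_right) auto
      finally show ?thesis .
    qed
    then have "(\<lambda>k. a * s k + b * t k) = (\<lambda>k. \<Sum>j<max n m. ?e j * x j k)" by simp
    then show ?thesis using in_S[of ?e "max n m"] by simp
  qed
  have SM: "S \<subseteq> M"
  proof
    fix s assume s: "s \<in> S"
    have "N (\<lambda>k. s k - s k) = 0" by (simp add: norm_zero)
    then have "\<exists>t\<in>S. N (\<lambda>k. t k - s k) < e" if "e > 0" for e
      using s that by (intro bexI[of _ s]) simp_all
    then show "s \<in> M" unfolding M_def using s SX by blast
  qed
  have "closed_subspace w M"
    unfolding closed_subspace_def
  proof (intro conjI ballI allI impI)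
    show "M \<subseteq> X" by (auto simp: M_def)
    show "(\<lambda>k. 0) \<in> M" using SM in_S[of _ 0] by auto
  next
    fix y z and a b :: real assume y: "y \<in> M" and z: "z \<in> M"
    then have X: "y \<in> X" "z \<in> X" by (auto simp: M_def)
    show "(\<lambda>k. a * y k + b * z k) \<in> M"
      unfolding M_def
    proof (intro CollectI conjI allI impI lin_in X)
      fix e :: real assume "e > 0"
      define d where "d = e / (\<bar>a\<bar> + \<bar>b\<bar> + 1)"
      have d: "d > 0" "(\<bar>a\<bar> + \<bar>b\<bar>) * d < e"
        unfolding d_def using \<open>e > 0\<close> by (auto simp: field_simps)
      obtain s where s: "s \<in> S" "N (\<lambda>k. s k - y k) < d" using y d by (auto simp: M_def)
      obtain t where t: "t \<in> S" "N (\<lambda>k. t k - z k) < d" using z d by (auto simp: M_def)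
      have st: "s \<in> X" "t \<in> X" using s t SX by auto
      have "N (\<lambda>k. a * s k + b * t k - (a * y k + b * z k))
          = N (\<lambda>k. a * (s k - y k) + b * (t k - z k))" by (simp add: algebra_simps)
      also have "\<dots> \<le> \<bar>a\<bar> * N (\<lambda>k. s k - y k) + \<bar>b\<bar> * N (\<lambda>k. t k - z k)"
        by (intro norm_lin diff_in st X)
      also have "\<dots> \<le> \<bar>a\<bar> * d + \<bar>b\<bar> * d"
        using s t by (intro add_mono mult_left_mono) auto
      also have "\<dots> < e" using d by (simp add: algebra_simps)
      finally show "\<exists>s\<in>S. N (\<lambda>k. s k - (a * y k + b * z k)) < e"
        by (rule bexI[OF _ S_lin[OF s(1) t(1)]])
    qed
  next
    fix y and s :: "nat \<Rightarrow> nat \<Rightarrow> real"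
    assume y: "y \<in> X" and s: "(\<forall>m. s m \<in> M) \<and> (\<lambda>m. N (\<lambda>k. s m k - y k)) \<longlonglongrightarrow> 0"
    show "y \<in> M"
      unfolding M_def
    proof (intro CollectI conjI allI impI y)
      fix e :: real assume e: "e > 0"
      then have "\<forall>\<^sub>F m in sequentially. N (\<lambda>k. s m k - y k) < e / 2"
        using s by (intro order_tendstoD) auto
      then obtain m where m: "N (\<lambda>k. s m k - y k) < e / 2" by (auto simp: eventually_sequentially)
      have "s m \<in> M" using s by simp
      then have sX: "s m \<in> X" and "\<forall>d>0. \<exists>t\<in>S. N (\<lambda>k. t k - s m k) < d"
        unfolding M_def by auto
      then obtain t where t: "t \<in> S" "N (\<lambda>k. t k - s m k) < e / 2"
        using half_gt_zero[OF e] by blast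
      have "N (\<lambda>k. 1 * (t k - s m k) + 1 * (s m k - y k))
          \<le> \<bar>1\<bar> * N (\<lambda>k. t k - s m k) + \<bar>1\<bar> * N (\<lambda>k. s m k - y k)"
        by (intro norm_lin diff_in y sX) (use t SX in auto)
      then have "N (\<lambda>k. t k - y k) < e" using t m by simp
      then show "\<exists>t\<in>S. N (\<lambda>k. t k - y k) < e" using t by blast
    qed
  qed
  moreover have "infinite_dim M"
    unfolding infinite_dim_def
  proof (intro allI exI conjI impI)
    fix n i :: nat
    let ?d = "\<lambda>j. if j = i then 1 else 0 :: real"
    have "(\<Sum>j<Suc i. ?d j * x j k) = x i k" for k
      by simp
    then have "x i \<in> S" using in_S[of ?d "Suc i"] by simp
    then show "x i \<in> M" using SM by auto
  next
    fix n i :: nat and a :: "nat \<Rightarrow> real"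
    assume a: "\<forall>k. (\<Sum>i<n. a i * x i k) = 0" and i: "i < n"
    have "(\<lambda>k. \<Sum>j<n. a j * T (x j) k) = (\<lambda>k. 0)"
      using op_sum[OF T, of n x a] x(1) op_zero[OF T] a by simp
    \<comment> \<open>A vanishing combination has vanishing image, so the lower estimate forces all
      coefficients to be 0.\<close>
    then have "c * (\<Sum>j<n. \<bar>a j\<bar>) \<le> 0" using lower[where a=a and n=n] by (simp add: norm_zero)
    then have "(\<Sum>j<n. \<bar>a j\<bar>) \<le> 0" using \<open>c > 0\<close> by (simp add: mult_le_0_iff)
    moreover have "\<bar>a i\<bar> \<le> (\<Sum>j<n. \<bar>a j\<bar>)" using i by (intro member_le_sum) auto
    ultimately show "a i = 0" by simp
  qed
  moreover have "\<exists>c>0. \<forall>y\<in>M. c * N y \<le> N (T y)"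
  proof -
    obtain C where C: "C > 0" "\<And>x. x \<in> X \<Longrightarrow> N (T x) \<le> C * N x"
      by (rule op_bound[OF T]) blast
    define D where "D = max B 1"
    have D: "D > 0" "\<And>j. N (x j) \<le> D" using x(2) by (auto simp: D_def le_max_iff_disj)
    \<comment> \<open>On the span, the sum of the moduli of the coefficients controls
      \<open>N s\<close> from above and \<open>N (T s)\<close> from below.\<close>
    have S_low: "c / D * N s \<le> N (T s)" if "s \<in> S" for s
    proof -
      obtain n a where s: "s = (\<lambda>k. \<Sum>j<n. a j * x j k)" using \<open>s \<in> S\<close> unfolding S_def by blast
      have "N s \<le> (\<Sum>j<n. \<bar>a j\<bar> * N (x j))" unfolding s by (rule norm_sum) (rule x)
      also have "\<dots> \<le> (\<Sum>j<n. \<bar>a j\<bar> * D)" by (intro sum_mono mult_left_mono D) auto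
      also have "\<dots> = D * (\<Sum>j<n. \<bar>a j\<bar>)" by (simp add: sum_distrib_left mult.commute)
      finally have "c / D * N s \<le> c / D * (D * (\<Sum>j<n. \<bar>a j\<bar>))"
        using D \<open>c > 0\<close> by (intro mult_left_mono) auto
      also have "\<dots> = c * (\<Sum>j<n. \<bar>a j\<bar>)" using D by simp
      also have "\<dots> \<le> N (T s)"
        using lower[where a=a and n=n] op_sum[OF T, of n x a] x(1) by (simp add: s)
      finally show ?thesis .
    qed
    have "c / D * N y \<le> N (T y)" if y: "y \<in> M" for y
    proof (rule field_le_epsilon)
      fix e :: real assume e: "e > 0"
      have yX: "y \<in> X" using y by (simp add: M_def)
      \<comment> \<open>Replacing \<open>y\<close> by \<open>s\<close> costs
        \<open>c / D * d\<close> on the left and \<open>C * d\<close> on the right, in total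
        \<open>e\<close>.\<close>
      define d where "d = e / (c / D + C)"
      have "c / D + C > 0" using C D \<open>c > 0\<close> by (simp add: add_pos_pos)
      then have d: "d > 0" "(c / D + C) * d = e" using e by (auto simp: d_def)
      obtain s where s: "s \<in> S" "N (\<lambda>k. s k - y k) < d" using y d by (auto simp: M_def)
      have sX: "s \<in> X" using s SX by auto
      have "N y \<le> N s + N (\<lambda>k. s k - y k)"
        using norm_triangle_sub[OF yX sX] norm_minus_commute[OF yX sX] by simp
      then have "c / D * N y \<le> c / D * (N s + d)"
        using s D \<open>c > 0\<close> by (intro mult_left_mono) auto
      also have "\<dots> \<le> N (T s) + c / D * d" using S_low[OF s(1)] by (simp add: distrib_left)
      also have "N (T s) \<le> N (T y) + N (\<lambda>k. T s k - T y k)"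
        by (intro norm_triangle_sub op_in[OF T] sX yX)
      also have "(\<lambda>k. T s k - T y k) = T (\<lambda>k. s k - y k)" using op_diff[OF T sX yX] by simp
      also have "N (T (\<lambda>k. s k - y k)) \<le> C * N (\<lambda>k. s k - y k)" by (intro C diff_in sX yX)
      also have "\<dots> \<le> C * d" using s C by simp
      finally show "c / D * N y \<le> N (T y) + e" using d(2) by (simp add: algebra_simps)
    qed
    then show ?thesis using D \<open>c > 0\<close> by (intro exI[of _ "c / D"]) auto
  qed
  ultimately show ?thesis unfolding strictly_singular_def by blast
qed

section \<open>The gliding hump\<close>

lemma convergent_coordinatewise_subseq:
  assumes "\<And>n. z n \<in> X" "\<And>n. N (z n) \<le> B"
  obtains r :: "nat \<Rightarrow> nat" and l where "strict_mono r" "\<And>i. (\<lambda>n. z (r n) i) \<longlonglongrightarrow> l i"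
proof -
  have "z n \<in> PiE UNIV (\<lambda>_. {- B..B})" for n
  proof -
    have "\<bar>z n i\<bar> \<le> B" for i using assms abs_le_norm order_trans by blast
    then show ?thesis by (simp add: PiE_UNIV_domain abs_le_iff minus_le_iff)
  qed
  then obtain l r where r: "strict_mono r" "(z \<circ> r) \<longlonglongrightarrow> l"
    using compact_imp_seq_compact[OF compact_bounded_functions] unfolding seq_compact_def by metis
  have "(\<lambda>n. z (r n) i) \<longlonglongrightarrow> l i" for i
    using continuous_on_tendsto_compose[OF continuous_on_product_coordinates r(2), of i]
    by (simp add: o_def)
  then show ?thesis using r(1) that by blast
qed

text \<open>Subtracting a fixed term of a coordinatewise convergent subsequence makes the head of
  the image small, and far out it hardly changes the value of \<open>f\<close> on a block. Iterating
  gives images close to disjoint blocks, from which the lower l1 estimate follows.\<close>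

lemma not_strictly_singular_if_large_blocks:
  assumes T: "bounded_op w T" and f: "f \<in> lorentz_dual w" and d: "d > 0"
    and large: "\<And>n. \<exists>m\<ge>n. \<exists>q. \<exists>x\<in>unit_ball w. d < \<bar>f (proj {m..<q} (T x))\<bar>"
  shows "\<not> strictly_singular w T"
proof -
  obtain C where C: "C > 0" "\<And>x. x \<in> X \<Longrightarrow> \<bar>f x\<bar> \<le> C * N x"
    by (rule dual_bound[OF f]) blast
  obtain D where D: "D > 0" "\<And>x. x \<in> X \<Longrightarrow> N (T x) \<le> D * N x"
    by (rule op_bound[OF T]) blast
  obtain M Q u where u: "\<And>n. M n \<ge> (n::nat)" "\<And>n. u n \<in> unit_ball w"
    "\<And>n. d < \<bar>f (proj {M n..<Q n} (T (u n)))\<bar>"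
    using large by metis
  have uX: "u n \<in> X" and uN: "N (u n) \<le> 1" for n using u(2) by (auto simp: unit_ball_def)
  have TX: "T (u n) \<in> X" for n by (rule op_in[OF T uX])
  have TN: "N (T (u n)) \<le> D" for n
    using order_trans[OF D(2)[OF uX] mult_left_le[OF uN]] D(1) by simp
  obtain r :: "nat \<Rightarrow> nat" and l where r: "strict_mono r" "\<And>i. (\<lambda>n. T (u (r n)) i) \<longlonglongrightarrow> l i"
    using convergent_coordinatewise_subseq[of "\<lambda>n. T (u n)" D] TX TN by metis
  \<comment> \<open>Head and tail errors of size \<open>e\<close> each cost together
    \<open>2 * C * e = d / 4\<close>, half of the value d / 2 kept on the blocks.\<close>
  define e where "e = d / (8 * C)"
  have e: "e > 0" using d C by (simp add: e_def)
  have "\<exists>x m q p. x \<in> X \<and> N x \<le> 2 \<and> n \<le> m \<and> m < q \<and> q \<le> p \<and> N (proj {..<n} (T x)) \<le> e \<and>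
      N (proj {p..} (T x)) \<le> e \<and> d / 2 < \<bar>f (proj {m..<q} (T x))\<bar>" for n
  proof -
    \<comment> \<open>Both terms of the difference are within \<open>h = a / 2\<close> of the limit
      on \<open>n\<close> coordinates, so the head has norm at most
      \<open>n * a \<le> e\<close>.\<close>
    define a where "a = e / (real n + 1)"
    define h where "h = a / 2"
    have h: "h > 0" using e by (simp add: h_def a_def)
    have "\<forall>\<^sub>F k in sequentially. \<forall>i\<in>{..<n}. dist (T (u (r k)) i) (l i) < h"
      by (intro eventually_ball_finite ballI tendstoD r h) simp
    then obtain k where k: "\<And>j i. k \<le> j \<Longrightarrow> i < n \<Longrightarrow> dist (T (u (r j)) i) (l i) < h"
      by (auto simp: eventually_sequentially)
    obtain q0 where q0: "N (proj {q0..} (T (u (r k)))) \<le> d / (2 * C)"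
      by (rule norm_tail[OF TX, of "d / (2 * C)"]) (use d C in auto)
    \<comment> \<open>Since \<open>r j \<ge> j\<close>, the large block of this term starts beyond
      \<open>n\<close> and beyond \<open>q0\<close>, where the subtracted image changes
      \<open>f\<close> by at most d / 2.\<close>
    define j where "j = max k (max n q0)"
    define m where "m = M (r j)"
    define q where "q = Q (r j)"
    have "j \<le> r j" using r(1) by (rule seq_suble)
    also have "r j \<le> m" unfolding m_def by (rule u)
    finally have m: "n \<le> m" "q0 \<le> m" by (auto simp: j_def)
    define x where "x = (\<lambda>i. u (r j) i - u (r k) i)"
    have x: "x \<in> X" unfolding x_def by (intro diff_in uX)
    have Tx: "T x = (\<lambda>i. T (u (r j)) i - T (u (r k)) i)"
      unfolding x_def by (rule op_diff[OF T uX uX])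
    have Nx: "N x \<le> 2"
      using norm_diff[OF uX uX, of "r j" "r k"] uN[of "r j"] uN[of "r k"] unfolding x_def by linarith
    have head: "N (proj {..<n} (T x)) \<le> e"
    proof -
      have "N (proj {..<n} (T x)) \<le> (\<Sum>i<n. \<bar>T x i\<bar>)" by (rule norm_finite_proj) simp
      also have "\<dots> \<le> (\<Sum>i<n. 2 * h)"
      proof (rule sum_mono)
        fix i assume "i \<in> {..<n}"
        then show "\<bar>T x i\<bar> \<le> 2 * h"
          using k[of j i] k[of k i] by (simp add: Tx dist_real_def j_def)
      qed
      also have "\<dots> = real n * a" by (simp add: h_def)
      also have "\<dots> \<le> e" using e by (simp add: a_def field_simps)
      finally show ?thesis .
    qed
    have "proj {m..<q} (T x)
        = (\<lambda>i. 1 * proj {m..<q} (T (u (r j))) i + (-1) * proj {m..<q} (T (u (r k))) i)"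
      by (auto simp: proj_def Tx)
    then have "f (proj {m..<q} (T x)) = 1 * f (proj {m..<q} (T (u (r j))))
        + (-1) * f (proj {m..<q} (T (u (r k))))"
      using dual_linear[OF f proj_in[OF TX] proj_in[OF TX]] by metis
    moreover have "\<bar>f (proj {m..<q} (T (u (r k))))\<bar> \<le> d / 2"
    proof -
      have "N (proj {m..<q} (T (u (r k)))) \<le> N (proj {q0..} (T (u (r k))))"
        using m by (intro norm_proj_mono TX) auto
      then have "C * N (proj {m..<q} (T (u (r k)))) \<le> C * (d / (2 * C))"
        using q0 C by (intro mult_left_mono) auto
      then show ?thesis using C(2)[OF proj_in[OF TX], of "{m..<q}" "r k"] C(1) by simp
    qed
    moreover have "d < \<bar>f (proj {m..<q} (T (u (r j))))\<bar>" unfolding m_def q_def by (rule u)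
    ultimately have big: "d / 2 < \<bar>f (proj {m..<q} (T x))\<bar>" by linarith
    have "m < q"
    proof (rule ccontr)
      assume "\<not> m < q"
      then have "proj {m..<q} (T x) = (\<lambda>k. 0)" by (simp add: proj_def)
      then show False using big dual_zero[OF f] d by simp
    qed
    obtain p0 where p0: "N (proj {p0..} (T x)) \<le> e" by (rule norm_tail[OF op_in[OF T x] e])
    have "N (proj {max p0 q..} (T x)) \<le> e"
      using norm_proj_mono[OF op_in[OF T x], of "{max p0 q..}" "{p0..}"] p0 by simp
    then show ?thesis
      using x Nx m(1) \<open>m < q\<close> head big
      by (intro exI[of _ x] exI[of _ m] exI[of _ q] exI[of _ "max p0 q"]) simp
  qed
  then obtain xx mm qq pp where step: "\<And>n. xx n \<in> X" "\<And>n. N (xx n) \<le> 2" "\<And>n. n \<le> mm n"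
    "\<And>n. mm n < qq n" "\<And>n. qq n \<le> pp n" "\<And>n. N (proj {..<n} (T (xx n))) \<le> e"
    "\<And>n. N (proj {pp n..} (T (xx n))) \<le> e"
    "\<And>n. d / 2 < \<bar>f (proj {mm n..<qq n} (T (xx n)))\<bar>"
    by metis
  \<comment> \<open>Each block starts where the tail of the previous image has become small.\<close>
  define P where "P = rec_nat 0 (\<lambda>_. pp)"
  have P: "P (Suc j) = pp (P j)" for j by (simp add: P_def)
  have "P j < P (Suc j)" for j
    using step(3-5)[of "P j"] by (simp add: P)
  then have P_mono: "strict_mono P" by (simp add: strict_mono_Suc_iff)
  define x where "x j = xx (P j)" for j
  define v where "v j = proj {mm (P j)..<qq (P j)} (T (x j))" for j
  define b where "b j = proj {P j..<P (Suc j)} (T (x j))" for j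
  have xX: "x j \<in> X" for j unfolding x_def by (rule step)
  have TxX: "T (x j) \<in> X" for j by (rule op_in[OF T xX])
  have vX: "v j \<in> X" and bX: "b j \<in> X" for j unfolding v_def b_def by (rule proj_in[OF TxX])+
  have fv: "d / 2 < \<bar>f (v j)\<bar>" for j unfolding v_def x_def by (rule step)
  have v0: "v j i = 0" if "i \<notin> {P j..<P (Suc j)}" for i j
    using that step(3,5)[of "P j"] by (auto simp: v_def proj_def P)
  have b0: "b j i = 0" if "i \<notin> {P j..<P (Suc j)}" for i j
    using that by (auto simp: b_def proj_def)
  have vb: "\<bar>v j i\<bar> \<le> \<bar>b j i\<bar>" for i j
    using step(3,5)[of "P j"] by (auto simp: v_def b_def proj_def P)
  note disj = strict_mono_interval_unique[OF P_mono]
  have lower: "d / (4 * C) * (\<Sum>j<n. \<bar>a j\<bar>) \<le> N (\<lambda>k. \<Sum>j<n. a j * T (x j) k)" for a n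
  proof -
    define A where "A = (\<Sum>j<n. \<bar>a j\<bar>)"
    \<comment> \<open>The signs make every \<open>c j * f (v j)\<close> nonnegative without changing
      the size of the coefficients.\<close>
    define c where "c j = \<bar>a j\<bar> * sgn (f (v j))" for j
    have "d / 2 * A \<le> (\<Sum>j<n. c j * f (v j))"
      unfolding A_def sum_distrib_left
    proof (rule sum_mono)
      fix j
      have "c j * f (v j) = \<bar>a j\<bar> * \<bar>f (v j)\<bar>" by (simp add: c_def abs_sgn mult.assoc)
      moreover have "\<bar>a j\<bar> * (d / 2) \<le> \<bar>a j\<bar> * \<bar>f (v j)\<bar>"
        using fv[of j] by (intro mult_left_mono) auto
      ultimately show "d / 2 * \<bar>a j\<bar> \<le> c j * f (v j)" by (simp add: mult.commute)
    qed
    also have "\<dots> = f (\<lambda>k. \<Sum>j<n. c j * v j k)" by (rule dual_sum[OF f vX, symmetric])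
    also have "\<dots> \<le> \<bar>f (\<lambda>k. \<Sum>j<n. c j * v j k)\<bar>" by (rule abs_ge_self)
    also have "\<dots> \<le> C * N (\<lambda>k. \<Sum>j<n. c j * v j k)" by (intro C sum_in vX)
    also have "\<dots> \<le> C * N (\<lambda>k. \<Sum>j<n. a j * b j k)"
    \<comment> \<open>At each index at most one block is nonzero, so the combination of the
      \<open>v j\<close> is dominated there by that of the larger blocks \<open>b j\<close>,
      whatever the signs.\<close>
    proof (intro mult_left_mono norm_mono sum_in bX)
      fix i
      show "\<bar>\<Sum>j<n. c j * v j i\<bar> \<le> \<bar>\<Sum>j<n. a j * b j i\<bar>"
      proof (cases "\<exists>k<n. i \<in> {P k..<P (Suc k)}")
        case True
        then obtain k where k: "k < n" "i \<in> {P k..<P (Suc k)}" by blast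
        have 0: "v j i = 0" "b j i = 0" if "j \<noteq> k" for j
          using v0 b0 disj[OF _ k(2)] that by blast+
        have "(\<Sum>j<n. c j * v j i) = (\<Sum>j\<in>{k}. c j * v j i)"
          by (rule sum.mono_neutral_right) (use k 0 in auto)
        moreover have "(\<Sum>j<n. a j * b j i) = (\<Sum>j\<in>{k}. a j * b j i)"
          by (rule sum.mono_neutral_right) (use k 0 in auto)
        moreover have "\<bar>c k * v k i\<bar> \<le> \<bar>a k * b k i\<bar>"
        proof -
          have "\<bar>c k\<bar> \<le> \<bar>a k\<bar>" by (simp add: c_def abs_mult abs_sgn_eq)
          then show ?thesis using vb by (simp add: abs_mult mult_mono)
        qed
        ultimately show ?thesis by simp
      next
        case False
        then have "v j i = 0" if "j < n" for j using v0 that by blast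
        then have "(\<Sum>j<n. c j * v j i) = 0" by simp
        then show ?thesis by simp
      qed
    qed (use C in auto)
    also have "N (\<lambda>k. \<Sum>j<n. a j * b j k) \<le> N (\<lambda>k. \<Sum>j<n. a j * T (x j) k)
        + N (\<lambda>k. (\<Sum>j<n. a j * b j k) - (\<Sum>j<n. a j * T (x j) k))"
      by (intro norm_triangle_sub sum_in bX TxX)
    also have "(\<lambda>k. (\<Sum>j<n. a j * b j k) - (\<Sum>j<n. a j * T (x j) k))
        = (\<lambda>k. \<Sum>j<n. a j * (b j k - T (x j) k))"
      by (simp add: sum_subtractf algebra_simps)
    also have "N \<dots> \<le> (\<Sum>j<n. \<bar>a j\<bar> * N (\<lambda>k. b j k - T (x j) k))"
      by (intro norm_sum diff_in bX TxX)
    also have "\<dots> \<le> (\<Sum>j<n. \<bar>a j\<bar> * (2 * e))"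
    proof (intro sum_mono mult_left_mono)
      fix j
      have "N (\<lambda>k. (-1) * proj {..<P j} (T (x j)) k + (-1) * proj {P (Suc j)..} (T (x j)) k)
          \<le> \<bar>-1\<bar> * N (proj {..<P j} (T (x j))) + \<bar>-1\<bar> * N (proj {P (Suc j)..} (T (x j)))"
        by (intro norm_lin proj_in TxX)
      also have "(\<lambda>k. (-1) * proj {..<P j} (T (x j)) k + (-1) * proj {P (Suc j)..} (T (x j)) k)
          = (\<lambda>k. b j k - T (x j) k)"
        using strict_monoD[OF P_mono, of j "Suc j"] by (intro ext) (auto simp: proj_def b_def)
      also have "\<bar>-1\<bar> * N (proj {..<P j} (T (x j))) + \<bar>-1\<bar> * N (proj {P (Suc j)..} (T (x j))) \<le> 2 * e"
        using step(6,7)[of "P j"] by (simp add: x_def P)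
      finally show "N (\<lambda>k. b j k - T (x j) k) \<le> 2 * e" .
    qed auto
    also have "\<dots> = 2 * e * A" by (simp add: A_def sum_distrib_left mult.commute)
    finally have "d / 2 * A \<le> C * (N (\<lambda>k. \<Sum>j<n. a j * T (x j) k) + 2 * e * A)"
      using C by simp
    moreover have "C * (2 * e * A) = d / 4 * A" using C by (simp add: e_def)
    ultimately have "d / 4 * A \<le> C * N (\<lambda>k. \<Sum>j<n. a j * T (x j) k)"
      by (simp only: distrib_left)
    then show ?thesis using C by (simp add: A_def field_simps)
  qed
  have "N (x j) \<le> 2" for j unfolding x_def by (rule step)
  moreover have "d / (4 * C) > 0" using d C by simp
  ultimately show ?thesis by (rule not_strictly_singularI[OF T xX _ _ lower])
qed

lemma strictly_singular_imp_weakly_compact: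
  assumes T: "bounded_op w T" and ss: "strictly_singular w T"
  shows "weakly_compact_op w T"
  unfolding weakly_compact_op_def
proof -
  obtain D where D: "D > 0" "\<And>x. x \<in> X \<Longrightarrow> N (T x) \<le> D * N x"
    by (rule op_bound[OF T]) blast
  show "compactin (weak_top w) (weak_top w closure_of T ` unit_ball w)"
  proof (rule weak_closure_compact)
    fix y assume "y \<in> T ` unit_ball w"
    then obtain x where x: "y = T x" "x \<in> X" "N x \<le> 1" by (auto simp: unit_ball_def)
    then show "y \<in> X" using op_in[OF T] by simp
    show "N y \<le> D" using order_trans[OF D(2)[OF x(2)] mult_left_le[OF x(3)]] D(1) x(1) by simp
  next
    fix f and e :: real assume f: "f \<in> lorentz_dual w" and e: "e > 0"
    show "\<exists>n. \<forall>m\<ge>n. \<forall>q. \<forall>y\<in>T ` unit_ball w. \<bar>f (proj {m..<q} y)\<bar> \<le> e"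
    proof (rule ccontr)
      assume "\<not> ?thesis"
      then have "\<exists>m\<ge>n. \<exists>q. \<exists>x\<in>unit_ball w. e < \<bar>f (proj {m..<q} (T x))\<bar>" for n
        by (auto simp: not_le)
      then show False using not_strictly_singular_if_large_blocks[OF T f e] ss by blast
    qed
  qed
qed

section \<open>Operators bounded below on an infinite-dimensional subspace\<close>

lemma norm_pos: "x \<in> X \<Longrightarrow> x k \<noteq> 0 \<Longrightarrow> 0 < N x"
  using abs_le_norm[of x k] by linarith

lemma closed_subspace_lin:
  "closed_subspace w M \<Longrightarrow> x \<in> M \<Longrightarrow> y \<in> M \<Longrightarrow> (\<lambda>k. a * x k + b * y k) \<in> M"
  by (simp add: closed_subspace_def)

lemma closed_subspace_sum:
  fixes n :: nat
  assumes M: "closed_subspace w M" and "\<And>i. i < n \<Longrightarrow> v i \<in> M"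
  shows "(\<lambda>k. \<Sum>i<n. c i * v i k) \<in> M"
  using assms(2)
proof (induction n)
  case 0
  then show ?case using M by (simp add: closed_subspace_def)
next
  case (Suc n)
  then have "(\<lambda>k. \<Sum>i<n. c i * v i k) \<in> M" "v n \<in> M" by auto
  then have "(\<lambda>k. 1 * (\<Sum>i<n. c i * v i k) + c n * v n k) \<in> M"
    by (rule closed_subspace_lin[OF M])
  then show ?case by simp
qed

lemma op_scale: "bounded_op w T \<Longrightarrow> x \<in> X \<Longrightarrow> T (\<lambda>k. a * x k) = (\<lambda>k. a * T x k)"
  using op_linear[of T x x a 0] by simp

text \<open>Among n + 1 independent vectors, n linear conditions leave a nontrivial combination;
  independence makes it nonzero, so it can be normalised.\<close>

lemma unit_vector_vanishing_image:
  assumes T: "bounded_op w T" and M: "closed_subspace w M" "infinite_dim M"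
  obtains x where "x \<in> M" "N x = 1" "\<And>k. k < n \<Longrightarrow> T x k = 0"
proof -
  have MX: "M \<subseteq> X" using M(1) by (simp add: closed_subspace_def)
  obtain v where v: "\<forall>i<Suc n. v i \<in> M"
    and ind: "\<forall>c. (\<forall>k. (\<Sum>i<Suc n. c i * v i k) = 0) \<longrightarrow> (\<forall>i<Suc n. c i = (0::real))"
    using M(2) unfolding infinite_dim_def by blast
  obtain c where c: "\<exists>i\<in>{..<Suc n}. c i \<noteq> 0"
    "\<forall>k\<in>{..<n}. (\<Sum>i<Suc n. c i * T (v i) k) = 0"
    using homogeneous_system_nontrivial[of "{..<n}" "{..<Suc n}" "\<lambda>i k. T (v i) k"] by auto
  define x where "x = (\<lambda>k. \<Sum>i<Suc n. c i * v i k)"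
  have x: "x \<in> M" unfolding x_def by (rule closed_subspace_sum[OF M(1)]) (use v in auto)
  obtain k where "x k \<noteq> 0" using ind c(1) unfolding x_def by blast
  then have Nx: "0 < N x" using norm_pos x MX by blast
  have Tx: "T x = (\<lambda>k. \<Sum>i<Suc n. c i * T (v i) k)"
    unfolding x_def by (rule op_sum[OF T]) (use v MX in auto)
  define z where "z = (\<lambda>k. 1 / N x * x k)"
  have "z \<in> M" using closed_subspace_lin[OF M(1) x x, of "1 / N x" 0] by (simp add: z_def)
  moreover have "N z = 1"
    unfolding z_def by (subst norm_scale) (use x MX Nx in auto)
  moreover have "T z k = 0" if "k < n" for k
  proof -
    have "T z = (\<lambda>k. 1 / N x * T x k)"
      unfolding z_def by (rule op_scale[OF T]) (use x MX in auto)
    then show ?thesis using c(2) that by (simp add: Tx del: sum.lessThan_Suc)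
  qed
  ultimately show ?thesis by (rule that)
qed

text \<open>Numbering \<open>F\<close> from 0 assigns the first, hence largest, weights to its
  entries.\<close>

lemma norm_ge_weights:
  assumes x: "x \<in> X" and F: "finite F" and e: "\<And>i. i \<in> F \<Longrightarrow> e \<le> \<bar>x i\<bar>"
  shows "e * sum w {..<card F} \<le> N x"
proof -
  obtain h where h: "bij_betw h F {0..<card F}" using ex_bij_betw_finite_nat[OF F] by blast
  have "e * sum w {..<card F} = (\<Sum>i\<in>F. w (h i) * e)"
    using sum.reindex_bij_betw[OF h, of "\<lambda>i. w i * e"]
    by (simp add: sum_distrib_left mult.commute atLeast0LessThan)
  also have "\<dots> \<le> (\<Sum>i\<in>F. w (h i) * \<bar>x i\<bar>)"
    by (intro sum_mono mult_left_mono w_nonneg e)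
  also have "\<dots> \<le> N x"
    by (rule rearr_boundD[OF rearr_bound_norm[OF x] F bij_betw_imp_inj_on[OF h]])
  finally show ?thesis .
qed

text \<open>If no image were flat, sums of many almost disjoint images would have bounded supremum norm
  but large Lorentz norm, because the weights are not summable.\<close>
lemma unit_vector_flat_image:
  assumes T: "bounded_op w T" and M: "closed_subspace w M" "infinite_dim M" and e: "e > 0"
    and c: "c > 0" "\<And>x. x \<in> M \<Longrightarrow> c * N x \<le> N (T x)"
  obtains x where "x \<in> M" "N x = 1" "\<And>k. k < n \<Longrightarrow> T x k = 0" "\<And>i. \<bar>T x i\<bar> \<le> e"
proof (rule ccontr)
  assume "\<not> thesis"
  then have large: "\<exists>i. e < \<bar>T x i\<bar>" if "x \<in> M" "N x = 1" "\<And>k. k < n \<Longrightarrow> T x k = 0" for x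
    using \<open>\<And>x. \<lbrakk>x \<in> M; N x = 1; \<And>k. k < n \<Longrightarrow> T x k = 0; \<And>i. \<bar>T x i\<bar> \<le> e\<rbrakk> \<Longrightarrow> thesis\<close> that
    by (meson not_le)
  have MX: "M \<subseteq> X" using M(1) by (simp add: closed_subspace_def)
  obtain D where D: "D > 0" "\<And>x. x \<in> X \<Longrightarrow> N (T x) \<le> D * N x"
    by (rule op_bound[OF T]) blast
  \<comment> \<open>Induction adds one peak at a time, each located beyond the essential part of the
    previous sum.\<close>
  have sums: "\<exists>s\<in>M. (\<forall>k<n. T s k = 0) \<and> (\<forall>i. \<bar>T s i\<bar> \<le> D + 1) \<and>
      (\<exists>F. finite F \<and> card F = m \<and> (\<forall>i\<in>F. e / 2 \<le> \<bar>T s i\<bar>))" for m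
  proof (induction m)
    case 0
    have "(\<lambda>k. 0) \<in> M" using M(1) by (simp add: closed_subspace_def)
    then show ?case
      using op_zero[OF T] D(1) by (intro bexI[of _ "\<lambda>k. 0"]) (auto intro!: exI[of _ "{}"])
  next
    case (Suc m)
    then obtain s F where s: "s \<in> M" "\<And>k. k < n \<Longrightarrow> T s k = 0" "\<And>i. \<bar>T s i\<bar> \<le> D + 1"
      and F: "finite F" "card F = m" "\<And>i. i \<in> F \<Longrightarrow> e / 2 \<le> \<bar>T s i\<bar>" by blast
    have sX: "s \<in> X" using s MX by auto
    \<comment> \<open>The remainder of \<open>T s\<close> beyond \<open>p\<close> must leave at
      least e / 2 of the new peak (hence e / 2) and raise the supremum by at most 1 (hence
      1).\<close>
    define h where "h = min 1 (e / 2)"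
    have h: "h > 0" "h \<le> 1" "h \<le> e / 2" using e by (auto simp: h_def)
    have "T s \<longlonglongrightarrow> 0" using op_in[OF T sX] by (simp add: lorentz_space_def)
    then have "\<forall>\<^sub>F i in sequentially. \<bar>T s i\<bar> < h"
      using h(1) by (simp add: tendsto_iff)
    then obtain p0 where p0: "\<And>i. p0 \<le> i \<Longrightarrow> \<bar>T s i\<bar> < h"
      by (auto simp: eventually_sequentially)
    define p where "p = max p0 n"
    obtain x where x: "x \<in> M" "N x = 1" "\<And>k. k < p \<Longrightarrow> T x k = 0"
      by (rule unit_vector_vanishing_image[OF T M]) blast
    have xX: "x \<in> X" using x MX by auto
    obtain i where i: "e < \<bar>T x i\<bar>" using large[OF x(1,2)] x(3) by (auto simp: p_def)
    have ip: "p \<le> i" using i x(3)[of i] e by (cases "p \<le> i") auto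
    have Fp: "j < p" if "j \<in> F" for j
    proof (rule ccontr)
      assume "\<not> j < p"
      then have "\<bar>T s j\<bar> < h" by (intro p0) (simp add: p_def)
      then show False using F(3)[OF that] h(3) by linarith
    qed
    have Txb: "\<bar>T x j\<bar> \<le> D" for j
      using order_trans[OF abs_le_norm[OF op_in[OF T xX]] D(2)[OF xX]] x(2) by simp
    define t where "t = (\<lambda>k. 1 * s k + 1 * x k)"
    have Tt: "T t j = T s j + T x j" for j
      unfolding t_def op_linear[OF T sX xX] by simp
    have "t \<in> M" unfolding t_def by (rule closed_subspace_lin[OF M(1) s(1) x(1)])
    moreover have "\<forall>k<n. T t k = 0" using s(2) x(3) by (simp add: Tt p_def)
    moreover have "\<bar>T t j\<bar> \<le> D + 1" for j
    proof (cases "j < p")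
      case True
      then show ?thesis using s(3) x(3) by (simp add: Tt)
    next
      case False
      then have "\<bar>T s j\<bar> < h" by (intro p0) (simp add: p_def)
      then show ?thesis using Txb[of j] h(2) unfolding Tt by linarith
    qed
    moreover have "e / 2 \<le> \<bar>T t j\<bar>" if "j \<in> insert i F" for j
    proof (cases "j = i")
      case True
      have "\<bar>T s i\<bar> < h" using ip by (intro p0) (simp add: p_def)
      then show ?thesis using i h(3) unfolding Tt True by linarith
    next
      case False
      then have "j \<in> F" using that by auto
      then show ?thesis using F(3) x(3)[OF Fp] by (simp add: Tt)
    qed
    moreover have "card (insert i F) = Suc m" using F Fp ip by (subst card_insert_disjoint) force+
    ultimately show ?case using F(1) by (intro bexI[of _ t]) (auto intro!: exI[of _ "insert i F"])
  qed
  \<comment> \<open>With this many peaks \<open>N s\<close> exceeds \<open>(D + 1) / e\<close>, so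
    after normalisation the image has supremum norm below \<open>e\<close>, a contradiction.\<close>
  obtain m where m: "2 * D * (D + 1) / e\<^sup>2 < sum w {..<m}" using W_unbounded by blast
  obtain s F where s: "s \<in> M" "\<And>k. k < n \<Longrightarrow> T s k = 0" "\<And>i. \<bar>T s i\<bar> \<le> D + 1"
    and F: "finite F" "card F = m" "\<And>i. i \<in> F \<Longrightarrow> e / 2 \<le> \<bar>T s i\<bar>"
    using sums[of m] by blast
  have sX: "s \<in> X" using s MX by auto
  have "D * ((D + 1) / e) = e / 2 * (2 * D * (D + 1) / e\<^sup>2)"
    using e by (simp add: power2_eq_square field_simps)
  also have "\<dots> < e / 2 * sum w {..<card F}"
    using m e F(2) by (intro mult_strict_left_mono) auto
  also have "\<dots> \<le> N (T s)" by (rule norm_ge_weights[OF op_in[OF T sX] F(1,3)])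
  also have "\<dots> \<le> D * N s" by (rule D(2)[OF sX])
  finally have big: "(D + 1) / e < N s" using mult_less_cancel_left_pos[OF D(1)] by blast
  moreover have "0 < (D + 1) / e" using D e by simp
  ultimately have Ns: "0 < N s" by linarith
  define z where "z = (\<lambda>k. 1 / N s * s k)"
  have Tz: "T z = (\<lambda>k. 1 / N s * T s k)" unfolding z_def by (rule op_scale[OF T sX])
  have "z \<in> M" using closed_subspace_lin[OF M(1) s(1) s(1), of "1 / N s" 0] by (simp add: z_def)
  moreover have "N z = 1" unfolding z_def by (subst norm_scale[OF sX]) (use Ns in auto)
  moreover have "T z k = 0" if "k < n" for k using s(2)[OF that] by (simp add: Tz)
  ultimately obtain i where "e < \<bar>T z i\<bar>" using large by blast
  also have "\<bar>T z i\<bar> = \<bar>T s i\<bar> / N s" using Ns by (simp add: Tz)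
  also have "\<dots> \<le> (D + 1) / N s" using s(3) Ns by (intro divide_right_mono) auto
  finally show False using big Ns e by (simp add: field_simps)
qed

text \<open>One piece of the functional: both its support and the positions of its weights lie in
  \<open>{p..<q}\<close>, so pieces on consecutive intervals never share a weight. Flatness makes it
  harmless to skip the first \<open>p\<close> weights.\<close>

lemma flat_image_functional:
  assumes T: "bounded_op w T" and M: "closed_subspace w M" "infinite_dim M"
    and c: "c > 0" "\<And>x. x \<in> M \<Longrightarrow> c * N x \<le> N (T x)"
  shows "\<exists>x q h \<pi>. x \<in> M \<and> N x = 1 \<and> p < q \<and> (\<forall>k<p. T x k = 0) \<and>
    (\<forall>i. h i \<noteq> 0 \<longrightarrow> i \<in> {p..<q} \<and> \<pi> i \<in> {p..<q} \<and> \<bar>h i\<bar> \<le> w (\<pi> i)) \<and>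
    inj_on \<pi> {i. h i \<noteq> 0} \<and> c / 2 \<le> (\<Sum>i\<in>{p..<q}. h i * T x i) \<and>
    N (proj {q..} (T x)) \<le> c / 4"
proof -
  have MX: "M \<subseteq> X" using M(1) by (simp add: closed_subspace_def)
  \<comment> \<open>The first \<open>p\<close> weights, each at most 1, then account for at most c /
    4 of the norm.\<close>
  define e where "e = c / 4 / (real p + 1)"
  have e: "e > 0" using c by (simp add: e_def)
  obtain x where x: "x \<in> M" "N x = 1" "\<And>k. k < p \<Longrightarrow> T x k = 0" "\<And>i. \<bar>T x i\<bar> \<le> e"
    by (rule unit_vector_flat_image[OF T M e c]) blast+
  define y where "y = T x"
  have y: "y \<in> X" using x MX op_in[OF T] by (auto simp: y_def)
  have Ny: "c \<le> N y" using c(2)[OF x(1)] x(2) by (simp add: y_def)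
  have y0: "y k = 0" if "k < p" for k using x(3)[OF that] by (simp add: y_def)
  have ye: "\<bar>y i\<bar> \<le> e" for i using x(4) by (simp add: y_def)
  obtain g :: "nat \<Rightarrow> nat" where g: "inj g" "decseq (\<lambda>n. \<bar>y (g n)\<bar>)" "(\<lambda>n. w n * \<bar>y (g n)\<bar>) sums N y"
    by (rule norm_greedy[OF y])
  have "\<forall>\<^sub>F L in sequentially. 3 * c / 4 < (\<Sum>n<L. w n * \<bar>y (g n)\<bar>)"
    using g(3) Ny c(1) unfolding sums_def by (intro order_tendstoD) auto
  then obtain L where L: "3 * c / 4 < (\<Sum>n<L. w n * \<bar>y (g n)\<bar>)"
    by (auto simp: eventually_sequentially)
  obtain q0 where q0: "N (proj {q0..} y) \<le> c / 4"
    by (rule norm_tail[OF y, of "c / 4"]) (use c in auto)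
  define q where "q = Suc (q0 + p + L + Max (insert 0 (g ` {..<L})))"
  have gq: "g n < q" if "n < L" for n
  proof -
    have "g n \<le> Max (insert 0 (g ` {..<L}))" by (rule Max_ge) (use that in auto)
    then show ?thesis unfolding q_def by linarith
  qed
  \<comment> \<open>The n-th largest entry receives the weight at position p + n instead of
    n.\<close>
  define \<pi> where "\<pi> i = p + inv g i" for i
  define h where "h i = (if i \<in> g ` {..<L} then sgn (y i) * w (\<pi> i) else 0)" for i
  have h_supp: "y i \<noteq> 0 \<and> i \<in> g ` {..<L}" if "h i \<noteq> 0" for i
    using that by (auto simp: h_def split: if_splits)
  have "i \<in> {p..<q} \<and> \<pi> i \<in> {p..<q} \<and> \<bar>h i\<bar> \<le> w (\<pi> i)" if hi: "h i \<noteq> 0" for i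
  proof -
    obtain n where n: "n < L" "i = g n" using h_supp[OF hi] by auto
    have "p \<le> i" using h_supp[OF hi] y0 by (meson not_le)
    moreover have "\<pi> i = p + n" using g(1) by (simp add: \<pi>_def n)
    moreover have "\<bar>h i\<bar> \<le> w (\<pi> i)"
      using w_nonneg by (simp add: h_def abs_mult abs_sgn_eq)
    ultimately show ?thesis using n gq by (simp add: q_def)
  qed
  moreover have "inj_on \<pi> {i. h i \<noteq> 0}"
  proof (rule inj_onI)
    fix i j assume "i \<in> {i. h i \<noteq> 0}" "j \<in> {i. h i \<noteq> 0}" and eq: "\<pi> i = \<pi> j"
    then obtain n m where "i = g n" "j = g m" using h_supp by blast
    then show "i = j" using eq g(1) by (simp add: \<pi>_def)
  qed
  moreover have "c / 2 \<le> (\<Sum>i\<in>{p..<q}. h i * y i)"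
  proof -
    have "real p * e \<le> c / 4" using c(1) by (simp add: e_def field_simps)
    moreover have "(\<Sum>n<p. w n * \<bar>y (g n)\<bar>) \<le> (\<Sum>n<p. 1 * e)"
      using ye e by (intro sum_mono mult_mono w_le1) auto
    ultimately have "c / 2 \<le> (\<Sum>n<L. w n * \<bar>y (g n)\<bar>) - (\<Sum>n<p. w n * \<bar>y (g n)\<bar>)"
      using L by simp
    also have "\<dots> \<le> (\<Sum>n<p + L. w n * \<bar>y (g n)\<bar>) - (\<Sum>n<p. w n * \<bar>y (g n)\<bar>)"
      using w_nonneg by (intro diff_right_mono sum_mono2) auto
    also have "\<dots> = (\<Sum>n<L. w (p + n) * \<bar>y (g (p + n))\<bar>)"
    proof -
      have "sum F {..<p + L} = sum F {..<p} + (\<Sum>n<L. F (p + n))" for F :: "nat \<Rightarrow> real"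
        by (induction L) auto
      then show ?thesis by simp
    qed
    \<comment> \<open>Moving each weight to an earlier, larger entry can only increase the
      sum.\<close>
    also have "\<dots> \<le> (\<Sum>n<L. w (p + n) * \<bar>y (g n)\<bar>)"
      using decseqD[OF g(2)] by (intro sum_mono mult_left_mono w_nonneg) auto
    also have "\<dots> = (\<Sum>i\<in>g ` {..<L}. w (\<pi> i) * \<bar>y i\<bar>)"
      using g(1) by (subst sum.reindex) (auto simp: \<pi>_def intro: inj_on_subset)
    also have "\<dots> = (\<Sum>i\<in>g ` {..<L}. h i * y i)"
      by (rule sum.cong) (auto simp: h_def abs_sgn mult_ac)
    also have "\<dots> = (\<Sum>i\<in>{p..<q}. h i * y i)"
    proof (rule sum.mono_neutral_cong)
      show "h i * y i = 0" if "i \<in> {p..<q} - g ` {..<L}" for i using that by (simp add: h_def)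
      show "h i * y i = 0" if "i \<in> g ` {..<L} - {p..<q}" for i using that gq y0 by auto
    qed auto
    finally show ?thesis .
  qed
  moreover have "N (proj {q..} y) \<le> c / 4"
    using norm_proj_mono[OF y, of "{q..}" "{q0..}"] q0 by (simp add: q_def)
  moreover have "p < q" by (simp add: q_def)
  ultimately show ?thesis using x(1-3) unfolding y_def by blast
qed

text \<open>Signed weights assigned injectively: the supremum form of the norm bounds the partial
  sums of moduli, giving absolute convergence and a functional of norm at most 1.\<close>

lemma
  assumes h: "\<And>i. h i \<noteq> 0 \<Longrightarrow> \<bar>h i\<bar> \<le> w (\<pi> i)" "inj_on \<pi> {i. h i \<noteq> 0}"
  shows weight_functional_dual: "(\<lambda>x. \<Sum>i. h i * x i) \<in> lorentz_dual w"
    and weight_functional_le: "\<And>x. x \<in> X \<Longrightarrow> \<bar>\<Sum>i. h i * x i\<bar> \<le> N x"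
proof -
  have part: "(\<Sum>i<n. \<bar>h i * x i\<bar>) \<le> N x" if x: "x \<in> X" for n x
  proof -
    let ?F = "{i \<in> {..<n}. h i \<noteq> 0}"
    have "(\<Sum>i<n. \<bar>h i * x i\<bar>) = (\<Sum>i\<in>?F. \<bar>h i * x i\<bar>)"
      by (rule sum.mono_neutral_right) auto
    also have "\<dots> \<le> (\<Sum>i\<in>?F. w (\<pi> i) * \<bar>x i\<bar>)"
      using h(1) by (intro sum_mono) (auto simp: abs_mult intro!: mult_right_mono)
    also have "\<dots> \<le> N x"
      by (rule rearr_boundD[OF rearr_bound_norm[OF x]]) (auto intro: inj_on_subset[OF h(2)])
    finally show ?thesis .
  qed
  have sm: "summable (\<lambda>i. \<bar>h i * x i\<bar>)" if "x \<in> X" for x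
    by (rule summableI_nonneg_bounded[OF _ part[OF that]]) simp
  note sm' = summable_rabs_cancel[OF sm]
  show le: "\<bar>\<Sum>i. h i * x i\<bar> \<le> N x" if "x \<in> X" for x
    using order_trans[OF summable_rabs[OF sm[OF that]] suminf_le_const[OF sm[OF that] part[OF that]]] .
  have "(\<Sum>i. h i * (a * x i + b * y i)) = a * (\<Sum>i. h i * x i) + b * (\<Sum>i. h i * y i)"
    if "x \<in> X" "y \<in> X" for x y a b
  proof -
    have "(\<Sum>i. h i * (a * x i + b * y i)) = (\<Sum>i. a * (h i * x i) + b * (h i * y i))"
      by (simp add: algebra_simps)
    also have "\<dots> = (\<Sum>i. a * (h i * x i)) + (\<Sum>i. b * (h i * y i))"
      by (intro suminf_add[symmetric] summable_mult sm' that)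
    also have "\<dots> = a * (\<Sum>i. h i * x i) + b * (\<Sum>i. h i * y i)"
      by (simp add: suminf_mult sm' that)
    finally show ?thesis .
  qed
  then show "(\<lambda>x. \<Sum>i. h i * x i) \<in> lorentz_dual w"
    unfolding lorentz_dual_def using le by (auto intro!: exI[of _ 1])
qed

text \<open>Every point has a weak neighbourhood containing only finitely many \<open>y j\<close>: a
  nonzero coordinate separates it from late terms, and \<open>f\<close> separates 0 from all terms.
  Finitely many such sets cannot cover the sequence.\<close>

lemma separated_coordinatewise_null_not_compact:
  assumes y: "\<And>j::nat. y j \<in> T ` unit_ball w" and T: "bounded_op w T"
    and null: "\<And>k j. k < j \<Longrightarrow> y j k = 0"
    and f: "f \<in> lorentz_dual w" "d > 0" "\<And>j. d \<le> f (y j)"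
  shows "\<not> weakly_compact_op w T"
proof
  let ?K = "weak_top w closure_of T ` unit_ball w"
  assume "weakly_compact_op w T"
  then have K: "compactin (weak_top w) ?K" by (simp add: weakly_compact_op_def)
  define \<U> where "\<U> = {U. openin (weak_top w) U \<and> finite {j. y j \<in> U}}"
  have "?K \<subseteq> \<Union>\<U>"
  proof
    fix z assume "z \<in> ?K"
    then have z: "z \<in> X" using closure_of_subset_topspace[of "weak_top w"] topspace_weak_top by auto
    show "z \<in> \<Union>\<U>"
    proof (cases "\<exists>k. z k \<noteq> 0")
      case True
      then obtain k where k: "z k \<noteq> 0" by blast
      let ?U = "{x \<in> X. x k \<in> - {0}}"
      have "j \<le> k" if "y j \<in> ?U" for j
        using that null[of k j] by (cases "j \<le> k") auto
      then have "{j. y j \<in> ?U} \<subseteq> {..k}" by blast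
      then have "finite {j. y j \<in> ?U}" by (rule finite_subset) simp
      moreover have "openin (weak_top w) ?U" by (rule openin_weak_top[OF coordinate_dual]) auto
      ultimately have "?U \<in> \<U>" by (simp add: \<U>_def)
      then show ?thesis using z k by blast
    next
      case False
      then have "z = (\<lambda>k. 0)" by auto
      then have "f z = 0" using dual_zero[OF f(1)] by simp
      let ?U = "{x \<in> X. f x \<in> {..<d}}"
      have "{j. y j \<in> ?U} = {}" using f(3) by (auto simp: not_less)
      then have "finite {j. y j \<in> ?U}" by (simp only: finite.emptyI)
      moreover have "openin (weak_top w) ?U" by (rule openin_weak_top[OF f(1)]) auto
      ultimately have "?U \<in> \<U>" by (simp add: \<U>_def)
      moreover have "z \<in> ?U" using z \<open>f z = 0\<close> f(2) by simp
      ultimately show ?thesis by blast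
    qed
  qed
  moreover have "\<forall>U\<in>\<U>. openin (weak_top w) U" by (simp add: \<U>_def)
  ultimately obtain \<F> where F: "finite \<F>" "\<F> \<subseteq> \<U>" "?K \<subseteq> \<Union>\<F>"
    using K unfolding compactin_def by meson
  have TK: "T ` unit_ball w \<subseteq> ?K"
    by (rule closure_of_subset) (auto simp: topspace_weak_top unit_ball_def op_in[OF T])
  have cov: "y j \<in> \<Union>\<F>" for j by (rule subsetD[OF F(3) subsetD[OF TK y]])
  have "finite (\<Union>U\<in>\<F>. {j. y j \<in> U})" using F(1,2) by (auto simp: \<U>_def)
  then have "finite (UNIV :: nat set)"
    by (rule rev_finite_subset) (use cov in fast)
  then show False by simp
qed

lemma weakly_compact_imp_strictly_singular:
  assumes T: "bounded_op w T" and wc: "weakly_compact_op w T"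
  shows "strictly_singular w T"
  unfolding strictly_singular_def
proof
  assume "\<exists>M. closed_subspace w M \<and> infinite_dim M \<and> (\<exists>c>0. \<forall>x\<in>M. c * N x \<le> N (T x))"
  then obtain M c where M: "closed_subspace w M" "infinite_dim M"
    and c: "c > 0" "\<And>x. x \<in> M \<Longrightarrow> c * N x \<le> N (T x)" by blast
  have MX: "M \<subseteq> X" using M(1) by (simp add: closed_subspace_def)
  define G where "G p x q h \<sigma> \<longleftrightarrow> x \<in> M \<and> N x = 1 \<and> p < q \<and> (\<forall>k<p. T x k = 0) \<and>
    (\<forall>i. h i \<noteq> 0 \<longrightarrow> i \<in> {p..<q} \<and> \<sigma> i \<in> {p..<q} \<and> \<bar>h i\<bar> \<le> w (\<sigma> i)) \<and>
    inj_on \<sigma> {i. h i \<noteq> 0} \<and> c / 2 \<le> (\<Sum>i\<in>{p..<q}. h i * T x i) \<and>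
    N (proj {q..} (T x)) \<le> c / 4" for p x q h \<sigma>
  have "\<exists>x q h \<sigma>. G p x q h \<sigma>" for p
    unfolding G_def by (rule flat_image_functional[OF T M c])
  then obtain xx qq hh ss where G: "\<And>p. G p (xx p) (qq p) (hh p) (ss p)" by metis
  have step: "\<And>p. xx p \<in> M" "\<And>p. N (xx p) = 1" "\<And>p. p < qq p"
    "\<And>p k. k < p \<Longrightarrow> T (xx p) k = 0"
    "\<And>p i. hh p i \<noteq> 0 \<Longrightarrow> i \<in> {p..<qq p} \<and> ss p i \<in> {p..<qq p} \<and> \<bar>hh p i\<bar> \<le> w (ss p i)"
    "\<And>p. inj_on (ss p) {i. hh p i \<noteq> 0}" "\<And>p. c / 2 \<le> (\<Sum>i\<in>{p..<qq p}. hh p i * T (xx p) i)"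
    "\<And>p. N (proj {qq p..} (T (xx p))) \<le> c / 4"
    using G unfolding G_def by blast+
  define P where "P = rec_nat 0 (\<lambda>_. qq)"
  have P: "P (Suc j) = qq (P j)" for j by (simp add: P_def)
  have P_mono: "strict_mono P" using step(3) by (simp add: strict_mono_Suc_iff P)
  note disj = strict_mono_interval_unique[OF P_mono]
  \<comment> \<open>The number of the interval containing \<open>i\<close>, used to glue the pieces
    into one functional.\<close>
  define J where "J i = (THE j. i \<in> {P j..<P (Suc j)})" for i
  have J: "J i = j" if "i \<in> {P j..<P (Suc j)}" for i j
    unfolding J_def using that disj by blast
  define h where "h i = (if \<exists>j. i \<in> {P j..<P (Suc j)} then hh (P (J i)) i else 0)" for i
  define \<pi> where "\<pi> i = ss (P (J i)) i" for i
  have h: "h i = hh (P j) i" if "i \<in> {P j..<P (Suc j)}" for i j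
    using that J[OF that] by (auto simp: h_def)
  have h_block: "\<exists>j. i \<in> {P j..<P (Suc j)} \<and> hh (P j) i \<noteq> 0 \<and> \<pi> i = ss (P j) i" if "h i \<noteq> 0" for i
  proof -
    obtain j where j: "i \<in> {P j..<P (Suc j)}" using \<open>h i \<noteq> 0\<close> by (auto simp: h_def split: if_splits)
    then show ?thesis using that J[OF j] h[OF j] by (auto simp: \<pi>_def)
  qed
  have h_le: "\<bar>h i\<bar> \<le> w (\<pi> i)" if "h i \<noteq> 0" for i
    using h_block[OF that] h step(5) by fastforce
  \<comment> \<open>Within an interval this is injectivity of the piece; across intervals, the
    weight positions lie in disjoint intervals.\<close>
  have inj: "inj_on \<pi> {i. h i \<noteq> 0}"
  proof (rule inj_onI)
    fix i i' assume "i \<in> {i. h i \<noteq> 0}" "i' \<in> {i. h i \<noteq> 0}" and eq: "\<pi> i = \<pi> i'"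
    then obtain j j' where j: "hh (P j) i \<noteq> 0" "\<pi> i = ss (P j) i"
      and j': "hh (P j') i' \<noteq> 0" "\<pi> i' = ss (P j') i'" using h_block by blast
    have "\<pi> i \<in> {P j..<P (Suc j)}" "\<pi> i' \<in> {P j'..<P (Suc j')}"
      using step(5)[OF j(1)] step(5)[OF j'(1)] j j' by (simp_all add: P)
    then have "j = j'" using disj eq by metis
    then show "i = i'" using step(6)[of "P j"] j j' eq by (auto simp: inj_on_def)
  qed
  define f where "f x = (\<Sum>i. h i * x i)" for x
  have f: "f \<in> lorentz_dual w" and f_le: "\<And>x. x \<in> X \<Longrightarrow> \<bar>f x\<bar> \<le> N x"
    unfolding f_def using weight_functional_dual[OF h_le inj] weight_functional_le[OF h_le inj]
    by blast+
  define y where "y j = T (xx (P j))" for j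
  have yX: "y j \<in> X" for j unfolding y_def using op_in[OF T] step(1) MX by blast
  \<comment> \<open>The image vanishes before \<open>P j\<close>, its own piece yields at least c /
    2, and all later pieces together cost at most the norm of the tail, c / 4.\<close>
  have "c / 4 \<le> f (y j)" for j
  proof -
    let ?q = "P (Suc j)"
    have "y j = (\<lambda>k. 1 * proj {..<?q} (y j) k + 1 * proj {?q..} (y j) k)"
      by (rule ext) (auto simp: proj_def)
    then have "f (y j) = f (\<lambda>k. 1 * proj {..<?q} (y j) k + 1 * proj {?q..} (y j) k)" by simp
    also have "\<dots> = f (proj {..<?q} (y j)) + f (proj {?q..} (y j))"
      using dual_linear[OF f proj_in[OF yX] proj_in[OF yX], of 1 _ j 1 _ j] by simp
    also have "f (proj {..<?q} (y j)) = (\<Sum>i<?q. h i * y j i)"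
      unfolding f_def by (subst suminf_finite[of "{..<?q}"]) (auto simp: proj_def)
    also have "\<dots> = (\<Sum>i\<in>{P j..<?q}. hh (P j) i * y j i)"
      by (rule sum.mono_neutral_cong_right) (use h step(4) in \<open>auto simp: y_def not_le\<close>)
    also have "\<dots> \<ge> c / 2" using step(7)[of "P j"] by (simp add: y_def P)
    moreover have "- (c / 4) \<le> f (proj {?q..} (y j))"
      using f_le[OF proj_in[OF yX], of "{?q..}" j] step(8)[of "P j"] by (simp add: y_def P)
    ultimately show ?thesis by linarith
  qed
  moreover have "y j k = 0" if "k < j" for j k
    unfolding y_def using step(4) less_le_trans[OF that seq_suble[OF P_mono]] by blast
  moreover have "y j \<in> T ` unit_ball w" for j
    unfolding y_def unit_ball_def
    by (intro imageI CollectI conjI) (use step(1,2) MX in auto)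
  ultimately have "\<not> weakly_compact_op w T"
    using c(1) by (intro separated_coordinatewise_null_not_compact[OF _ T _ f, of y "c / 4"]) auto
  then show False using wc by simp
qed

end

theorem theorem3p6:
  fixes w :: "nat \<Rightarrow> real" and T :: "(nat \<Rightarrow> real) \<Rightarrow> (nat \<Rightarrow> real)"
  assumes "lorentz_weight w"
    and "bounded_op w T"
  shows "weakly_compact_op w T \<longleftrightarrow> strictly_singular w T"
proof -
  interpret lorentz w by unfold_locales fact
  show ?thesis
    using weakly_compact_imp_strictly_singular strictly_singular_imp_weakly_compact assms(2) by blast
qed

end
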